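(* Let $k$ be an uncountable field and let $D$ be a division algebra over $k$. Then the following are equivalent: (1) $D$ contains a free $k$-algebra on two generators; (2) $D(t)$ contains a free $k(t)$-algebra on two generators; (3) $D(t)$ contains a free $k$-algebra on two generators.
   Context: A division algebra over $k$ is a division ring whose center contains $k$. Here $t$ is a commutative indeterminate (commuting with all elements of $D$), and $D(t)$ denotes the quotient division ring of the Ore domain $D[t]$. For a field $F$ contained in the center of a division ring $D'$, "$D'$ contains a free $F$-algebra on two generators" means there are $x,y\in D'$ such that the $F$-subalgebra $F\langle x,y\rangle\subseteq D'$ is free (noncommutative) on $x,y$. *)

theory Defs
  imports
    "HOL-Algebra.Subrings"
    "HOL-Algebra.UnivPoly"
    "HOL-Library.Countable_Set"
begin

section \<open>Division algebras\<close>

text \<open>HOL-Algebra has only commutative fields; this is \<^locale>\<open>field\<close> without commutativity.\<close>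

locale skew_field = ring R for R (structure) +
  assumes one_not_zero: "\<one> \<noteq> \<zero>"
    and skew_field_Units: "Units R = carrier R - {\<zero>}"

definition ring_center :: "('a, 'm) ring_scheme \<Rightarrow> 'a set" where
  "ring_center R =
    {z \<in> carrier R. \<forall>x \<in> carrier R. z \<otimes>\<^bsub>R\<^esub> x = x \<otimes>\<^bsub>R\<^esub> z}"

text \<open>The base field is a subset of the division ring, not a separate structure.\<close>

definition division_algebra :: "'a set \<Rightarrow> ('a, 'm) ring_scheme \<Rightarrow> bool" where
  "division_algebra K D \<longleftrightarrow> skew_field D \<and> subfield K D \<and> K \<subseteq> ring_center D"


section \<open>The quotient division ring\<close>

text \<open>
  \<open>D[t]\<close> is \<^term>\<open>UP D\<close>: its product is the convolution
  \<open>(p q)\<^sub>n = \<Sum>i\<le>n. p\<^sub>i q\<^sub>n\<^sub>-\<^sub>i\<close>, so \<open>t\<close> commutes with the coefficients, and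
  \<open>D\<close> is not assumed commutative.

  A quotient division ring of a right Ore domain \<open>A\<close> is unique up to a unique isomorphism
  over \<open>A\<close>. It is therefore described by a predicate on pairs \<open>(Q, \<iota>)\<close>. For a domain that is
  left and right Ore, as \<open>D[t]\<close> is, right fractions and left fractions give the same ring.
\<close>

definition quotient_division_ring ::
    "('p, 'm) ring_scheme \<Rightarrow> ('q, 'n) ring_scheme \<Rightarrow> ('p \<Rightarrow> 'q) \<Rightarrow> bool" where
  "quotient_division_ring A Q \<iota> \<longleftrightarrow>
    skew_field Q \<and> \<iota> \<in> ring_hom A Q \<and> inj_on \<iota> (carrier A) \<and>
    carrier Q = {\<iota> a \<otimes>\<^bsub>Q\<^esub> inv\<^bsub>Q\<^esub> (\<iota> b) | a b. a \<in> carrier A \<and> b \<in> carrier A - {\<zero>\<^bsub>A\<^esub>}}"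

text \<open>The copies of \<open>k\<close> and \<open>k(t)\<close> inside \<open>D(t)\<close>, where \<open>\<iota>\<close> embeds \<open>D[t]\<close> into \<open>D(t)\<close>.\<close>

definition const_image ::
    "'a set \<Rightarrow> ('a, 'm) ring_scheme \<Rightarrow> ((nat \<Rightarrow> 'a) \<Rightarrow> 'q) \<Rightarrow> 'q set" where
  "const_image K D \<iota> = {\<iota> (monom (UP D) c 0) | c. c \<in> K}"

definition polys_over :: "'a set \<Rightarrow> ('a, 'm) ring_scheme \<Rightarrow> (nat \<Rightarrow> 'a) set" where
  "polys_over K D = {p \<in> carrier (UP D). \<forall>n. coeff (UP D) p n \<in> K}"

definition rat_funs ::
    "'a set \<Rightarrow> ('a, 'm) ring_scheme \<Rightarrow> ('q, 'n) ring_scheme \<Rightarrow> ((nat \<Rightarrow> 'a) \<Rightarrow> 'q) \<Rightarrow> 'q set" where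
  "rat_funs K D Q \<iota> =
    {\<iota> p \<otimes>\<^bsub>Q\<^esub> inv\<^bsub>Q\<^esub> (\<iota> q) | p q.
      p \<in> polys_over K D \<and> q \<in> polys_over K D - {\<zero>\<^bsub>UP D\<^esub>}}"


section \<open>Free subalgebras\<close>

text \<open>
  Words in the two letters \<open>X\<close>, \<open>Y\<close> are boolean lists (\<open>True\<close> for \<open>X\<close>, \<open>False\<close> for \<open>Y\<close>), and
  an element of the free algebra \<open>F\<langle>X,Y\<rangle>\<close> is a finitely supported \<open>F\<close>-valued function on
  words. The subalgebra \<open>F\<langle>x,y\<rangle>\<close> is the image of the evaluation homomorphism
  \<open>X \<mapsto> x, Y \<mapsto> y\<close>; it is free on \<open>x, y\<close> iff this homomorphism is injective. For this map to be
  a homomorphism, \<open>F\<close> has to be central in \<open>R\<close>.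
\<close>

definition free_algebra_carrier ::
    "('a, 'm) ring_scheme \<Rightarrow> 'a set \<Rightarrow> (bool list \<Rightarrow> 'a) set" where
  "free_algebra_carrier R F = {f. range f \<subseteq> F \<and> finite {w. f w \<noteq> \<zero>\<^bsub>R\<^esub>}}"

primrec word_eval :: "('a, 'm) ring_scheme \<Rightarrow> 'a \<Rightarrow> 'a \<Rightarrow> bool list \<Rightarrow> 'a" where
  "word_eval R x y [] = \<one>\<^bsub>R\<^esub>"
| "word_eval R x y (b # w) = (if b then x else y) \<otimes>\<^bsub>R\<^esub> word_eval R x y w"

definition free_algebra_eval ::
    "('a, 'm) ring_scheme \<Rightarrow> 'a \<Rightarrow> 'a \<Rightarrow> (bool list \<Rightarrow> 'a) \<Rightarrow> 'a" where
  "free_algebra_eval R x y f =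
    (\<Oplus>\<^bsub>R\<^esub> w \<in> {w. f w \<noteq> \<zero>\<^bsub>R\<^esub>}. f w \<otimes>\<^bsub>R\<^esub> word_eval R x y w)"

definition contains_free_algebra :: "('a, 'm) ring_scheme \<Rightarrow> 'a set \<Rightarrow> bool" where
  "contains_free_algebra R F \<longleftrightarrow>
    (\<exists>x \<in> carrier R. \<exists>y \<in> carrier R.
      inj_on (free_algebra_eval R x y) (free_algebra_carrier R F))"

end

theory Submission
  imports Defs
begin

text \<open>
  Freeness of a pair \<open>x, y\<close> over a central subfield can be tested by inequations that do not mention
  the subfield. Suppose that distinct words \<open>w\<^sub>1, \<dots>, w\<^sub>m\<close> in \<open>x, y\<close> satisfy a relation
  \<open>\<Sum> c\<^sub>i w\<^sub>i = 0\<close> with central \<open>c\<^sub>i\<close>. Multiplying it by \<open>s w\<^sub>1\<close> on the right and by \<open>w\<^sub>1 s\<close> on the left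
  and subtracting removes the first term and leaves a relation with the same coefficients between
  the elements \<open>w\<^sub>i s w\<^sub>1 - w\<^sub>1 s w\<^sub>i\<close>, \<open>i \<ge> 2\<close>. Iterating this produces an integer combination
  \<open>C(x,y)\<close> of words, depending only on the list \<open>w\<^sub>1, \<dots>, w\<^sub>m\<close>, with \<open>c\<^sub>m C(x,y) = 0\<close>. If the words \<open>s\<close>
  are chosen as \<open>X Y\<^sup>n\<close> with \<open>n\<close> large, all words in \<open>C\<close> are distinct and \<open>C\<close> has coefficients
  \<open>1\<close> and \<open>-1\<close>. In a division ring, \<open>x, y\<close> is therefore free over a central subfield if and only if
  \<open>C(x,y) \<noteq> 0\<close> for each of the countably many lists of distinct words; this is
  \<open>free_iff_capelli_free\<close>.

  This makes the choice between \<open>k\<close> and \<open>k(t)\<close> as base field of \<open>D(t)\<close> immaterial, and a free pair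
  in \<open>D\<close> stays free in \<open>D(t)\<close> because the inequations pass through embeddings.

  For the passage from \<open>D(t)\<close> to \<open>D\<close>, the indeterminate is specialized to \<open>a \<in> k\<close>. The elements of
  \<open>D(t)\<close> are fractions \<open>p q\<^sup>-\<^sup>1\<close>, a nonzero polynomial over \<open>D\<close> has only finitely many central roots,
  and so a nonzero element of \<open>D(t)\<close> has a nonzero value at all but finitely many points of \<open>k\<close>.
  Given a free pair \<open>x, y\<close> in \<open>D(t)\<close>, this applies to each \<open>C(x,y)\<close>. As there are countably many \<open>C\<close>
  and \<open>k\<close> is uncountable, some \<open>a\<close> keeps all of them nonzero, and \<open>x(a), y(a)\<close> is a free pair in
  \<open>D\<close> (\<open>capelli_free_specialization\<close>).
\<close>

section \<open>Words and integer combinations of words\<close>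

definition list_sum :: "('a, 'm) ring_scheme \<Rightarrow> 'a list \<Rightarrow> 'a" where
  "list_sum R xs = foldr (add R) xs \<zero>\<^bsub>R\<^esub>"

context ring
begin

lemma list_sum_Nil [simp]: "list_sum R [] = \<zero>"
  and list_sum_Cons [simp]: "list_sum R (a # as) = a \<oplus> list_sum R as"
  by (simp_all add: list_sum_def)

lemma list_sum_closed [simp]: "set as \<subseteq> carrier R \<Longrightarrow> list_sum R as \<in> carrier R"
  by (induction as) auto

lemma list_sum_append:
  "set as \<subseteq> carrier R \<Longrightarrow> set bs \<subseteq> carrier R \<Longrightarrow>
    list_sum R (as @ bs) = list_sum R as \<oplus> list_sum R bs"
  by (induction as) (auto simp: a_assoc)

lemma list_sum_distrib_left:
  "a \<in> carrier R \<Longrightarrow> set bs \<subseteq> carrier R \<Longrightarrow>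
    list_sum R (map (\<lambda>b. a \<otimes> b) bs) = a \<otimes> list_sum R bs"
  by (induction bs) (auto simp: r_distr)

lemma list_sum_neg:
  "set bs \<subseteq> carrier R \<Longrightarrow> list_sum R (map (\<lambda>b. \<ominus> b) bs) = \<ominus> list_sum R bs"
  by (induction bs) (auto simp: minus_add)

lemma list_sum_distinct:
  "distinct ws \<Longrightarrow> (\<And>w. w \<in> set ws \<Longrightarrow> f w \<in> carrier R) \<Longrightarrow>
    list_sum R (map f ws) = finsum R f (set ws)"
  by (induction ws) (auto simp: finsum_insert)

lemma word_eval_closed [simp]:
  "x \<in> carrier R \<Longrightarrow> y \<in> carrier R \<Longrightarrow> word_eval R x y w \<in> carrier R"
  by (induction w) auto

lemma word_eval_append:
  "x \<in> carrier R \<Longrightarrow> y \<in> carrier R \<Longrightarrow>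
    word_eval R x y (u @ v) = word_eval R x y u \<otimes> word_eval R x y v"
  by (induction u) (auto simp: m_assoc)

end

text \<open>
  A list of signed words (\<open>True\<close> for plus) stands for an element of the free ring
  \<open>\<int>\<langle>X,Y\<rangle>\<close>. The coefficients are signs, so that one and the same expression can be evaluated
  in \<open>D\<close> and in \<open>D(t)\<close>; and if its words are distinct, it is a nonzero element of the free
  algebra over any base field.
\<close>

type_synonym signed_words = "(bool \<times> bool list) list"

fun signed_word_eval :: "('a, 'm) ring_scheme \<Rightarrow> 'a \<Rightarrow> 'a \<Rightarrow> bool \<times> bool list \<Rightarrow> 'a" where
  "signed_word_eval R x y (b, w) =
    (if b then word_eval R x y w else \<ominus>\<^bsub>R\<^esub> word_eval R x y w)"

definition signed_eval :: "('a, 'm) ring_scheme \<Rightarrow> 'a \<Rightarrow> 'a \<Rightarrow> signed_words \<Rightarrow> 'a" where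
  "signed_eval R x y z = list_sum R (map (signed_word_eval R x y) z)"

abbreviation words :: "signed_words \<Rightarrow> bool list list" where
  "words z \<equiv> map snd z"

definition signed_mult :: "signed_words \<Rightarrow> signed_words \<Rightarrow> signed_words" where
  "signed_mult z z' = map (\<lambda>((b, u), (b', u')). (b = b', u @ u')) (List.product z z')"

definition signed_neg :: "signed_words \<Rightarrow> signed_words" where
  "signed_neg = map (\<lambda>(b, u). (\<not> b, u))"

text \<open>
  The element \<open>z' s z - z s z'\<close>, a commutator with the word \<open>s\<close> put between the factors. Its
  value vanishes for \<open>z' = z\<close> and is linear over the centre in \<open>z'\<close>; hence it turns a central
  linear relation between \<open>z\<close> and further elements into one between the further elements alone.
\<close>

definition twisted_commutator :: "bool list \<Rightarrow> signed_words \<Rightarrow> signed_words \<Rightarrow> signed_words" where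
  "twisted_commutator s z z' =
    signed_mult z' (signed_mult [(True, s)] z) @
    signed_neg (signed_mult z (signed_mult [(True, s)] z'))"

context ring
begin

context
  fixes x y
  assumes xy: "x \<in> carrier R" "y \<in> carrier R"
begin

lemma signed_word_eval_closed [simp]: "signed_word_eval R x y bw \<in> carrier R"
  using xy by (cases bw) auto

lemma signed_word_eval_image: "signed_word_eval R x y ` A \<subseteq> carrier R"
  using signed_word_eval_closed by blast

lemma signed_eval_closed [simp]: "signed_eval R x y z \<in> carrier R"
  by (simp add: signed_eval_def signed_word_eval_image)

lemma signed_eval_append:
  "signed_eval R x y (z @ z') = signed_eval R x y z \<oplus> signed_eval R x y z'"
  by (simp add: signed_eval_def list_sum_append signed_word_eval_image)

lemma signed_eval_neg: "signed_eval R x y (signed_neg z) = \<ominus> signed_eval R x y z"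
proof -
  have "signed_word_eval R x y (case p of (b, u) \<Rightarrow> (\<not> b, u)) = \<ominus> signed_word_eval R x y p" for p
    using xy by (cases p) auto
  then have "map (signed_word_eval R x y) (signed_neg z) =
      map (\<lambda>a. \<ominus> a) (map (signed_word_eval R x y) z)"
    by (simp add: signed_neg_def)
  then show ?thesis
    by (simp only: signed_eval_def) (rule list_sum_neg, simp add: signed_word_eval_image)
qed

lemma signed_eval_mult:
  "signed_eval R x y (signed_mult z z') = signed_eval R x y z \<otimes> signed_eval R x y z'"
proof (induction z)
  case Nil
  have "signed_eval R x y [] = \<zero>" by (simp add: signed_eval_def)
  then show ?case by (simp add: signed_mult_def)
next
  case (Cons p z)
  have "signed_word_eval R x y (case (p, q) of ((b, u), (b', u')) \<Rightarrow> (b = b', u @ u')) =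
      signed_word_eval R x y p \<otimes> signed_word_eval R x y q" for q
    using xy by (cases p; cases q) (auto simp: word_eval_append l_minus r_minus)
  then have "signed_eval R x y (map (\<lambda>q. case (p, q) of ((b, u), (b', u')) \<Rightarrow> (b = b', u @ u')) z') =
      list_sum R (map (\<lambda>a. signed_word_eval R x y p \<otimes> a) (map (signed_word_eval R x y) z'))"
    by (simp add: signed_eval_def comp_def)
  also have "\<dots> = signed_word_eval R x y p \<otimes> signed_eval R x y z'"
    unfolding signed_eval_def by (rule list_sum_distrib_left) (simp_all add: signed_word_eval_image)
  finally have *: "signed_eval R x y (map (\<lambda>q. case (p, q) of ((b, u), (b', u')) \<Rightarrow> (b = b', u @ u')) z') =
    signed_word_eval R x y p \<otimes> signed_eval R x y z'" .
  have "signed_mult (p # z) z' =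
      map (\<lambda>q. case (p, q) of ((b, u), (b', u')) \<Rightarrow> (b = b', u @ u')) z' @ signed_mult z z'"
    by (simp add: signed_mult_def comp_def split_def)
  then have "signed_eval R x y (signed_mult (p # z) z') =
      signed_word_eval R x y p \<otimes> signed_eval R x y z' \<oplus> signed_eval R x y z \<otimes> signed_eval R x y z'"
    by (simp only: signed_eval_append * Cons.IH)
  moreover have "signed_eval R x y (p # z) = signed_word_eval R x y p \<oplus> signed_eval R x y z"
    by (simp add: signed_eval_def)
  ultimately show ?case
    by (simp add: l_distr)
qed

lemma signed_eval_single: "signed_eval R x y [(True, w)] = word_eval R x y w"
  using xy by (simp add: signed_eval_def)

lemma signed_eval_twisted_commutator:
  "signed_eval R x y (twisted_commutator s z z') =
    signed_eval R x y z' \<otimes> (word_eval R x y s \<otimes> signed_eval R x y z) \<ominus>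
    signed_eval R x y z \<otimes> (word_eval R x y s \<otimes> signed_eval R x y z')"
  by (simp add: twisted_commutator_def signed_eval_append signed_eval_neg signed_eval_mult
      signed_eval_single a_minus_def)

end

end

section \<open>Elimination of central coefficients\<close>

text \<open>
  The word \<open>X Y\<^sup>n\<close>. Put between two words of which the first has length at most \<open>n\<close>, it marks
  the place where they were joined.
\<close>

definition separator :: "nat \<Rightarrow> bool list" where
  "separator n = True # replicate n False"

text \<open>A crude bound on the length of every word that occurs in \<open>zs\<close>.\<close>

definition total_length :: "signed_words list \<Rightarrow> nat" where
  "total_length zs = length (concat (concat (map words zs)))"

text \<open>
  Gaussian elimination for a relation \<open>\<Sum> c\<^sub>i z\<^sub>i = 0\<close> with unknown central coefficients \<open>c\<^sub>i\<close>:
  each step removes the first element from all the others. The result plays the part of the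
  Capelli polynomial, whose vanishing is a consequence of linear dependence over the centre that
  does not mention the coefficients. The elimination has two advantages over the alternating sum:
  no permutations occur, and the separators can be chosen anew in each step. The value on the
  empty list is arbitrary.
\<close>

function capelli :: "signed_words list \<Rightarrow> signed_words" where
  "capelli [] = []"
| "capelli [z] = z"
| "capelli (z # z' # zs) =
    capelli (map (twisted_commutator (separator (total_length (z # z' # zs))) z) (z' # zs))"
  by pat_completeness auto
termination by (relation "measure length") auto

definition central_sum ::
    "('a, 'm) ring_scheme \<Rightarrow> 'a \<Rightarrow> 'a \<Rightarrow> ('a \<times> signed_words) list \<Rightarrow> 'a" where
  "central_sum R x y cz = list_sum R (map (\<lambda>(c, z). c \<otimes>\<^bsub>R\<^esub> signed_eval R x y z) cz)"

context ring
begin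

lemma center_carrier: "c \<in> ring_center R \<Longrightarrow> c \<in> carrier R"
  by (simp add: ring_center_def)

lemma center_commute: "c \<in> ring_center R \<Longrightarrow> a \<in> carrier R \<Longrightarrow> c \<otimes> a = a \<otimes> c"
  by (simp add: ring_center_def)

lemma center_diff: "a \<in> ring_center R \<Longrightarrow> b \<in> ring_center R \<Longrightarrow> a \<ominus> b \<in> ring_center R"
  by (auto simp: ring_center_def a_minus_def l_distr r_distr l_minus r_minus)

lemma center_mult:
  assumes a: "a \<in> ring_center R" and b: "b \<in> ring_center R"
  shows "a \<otimes> b \<in> ring_center R"
proof -
  have cl: "a \<in> carrier R" "b \<in> carrier R" using a b by (simp_all add: center_carrier)
  have "a \<otimes> b \<otimes> x = x \<otimes> (a \<otimes> b)" if x: "x \<in> carrier R" for x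
  proof -
    have "a \<otimes> b \<otimes> x = a \<otimes> x \<otimes> b" using cl x center_commute[OF b x] by (simp add: m_assoc)
    then show ?thesis using cl x center_commute[OF a x] by (simp add: m_assoc)
  qed
  then show ?thesis using cl by (simp add: ring_center_def)
qed

lemma central_sum_closed:
  "x \<in> carrier R \<Longrightarrow> y \<in> carrier R \<Longrightarrow> fst ` set cz \<subseteq> ring_center R \<Longrightarrow>
    central_sum R x y cz \<in> carrier R"
  unfolding central_sum_def by (rule list_sum_closed) (auto dest!: center_carrier)

lemma central_sum_Cons:
  "central_sum R x y ((c, z) # cz) = c \<otimes> signed_eval R x y z \<oplus> central_sum R x y cz"
  by (simp add: central_sum_def)

text \<open>
  Because the coefficients are central, they can be moved past \<open>z s\<close>; the twisted commutator with
  \<open>z\<close> is therefore linear over the centre.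
\<close>

lemma central_sum_twisted_commutator:
  assumes xy: "x \<in> carrier R" "y \<in> carrier R"
    and c: "fst ` set cz \<subseteq> ring_center R"
  shows "central_sum R x y (map (apsnd (twisted_commutator s z)) cz) =
    central_sum R x y cz \<otimes> (word_eval R x y s \<otimes> signed_eval R x y z) \<ominus>
    signed_eval R x y z \<otimes> (word_eval R x y s \<otimes> central_sum R x y cz)"
  using c
proof (induction cz)
  case Nil
  then show ?case using xy by (simp add: central_sum_def a_minus_def)
next
  case (Cons p cz)
  obtain c z' where p: "p = (c, z')" by (cases p)
  define e where "e = signed_eval R x y z"
  define e' where "e' = signed_eval R x y z'"
  define s' where "s' = word_eval R x y s"
  define T where "T = central_sum R x y cz"
  have cc: "c \<in> ring_center R" using Cons.prems p by auto
  have cl: "c \<in> carrier R" "e \<in> carrier R" "e' \<in> carrier R" "s' \<in> carrier R" "T \<in> carrier R"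
    using xy Cons.prems cc by (auto simp: e_def e'_def s'_def T_def center_carrier
        intro!: central_sum_closed)
  have comm: "e \<otimes> (s' \<otimes> (c \<otimes> e')) = c \<otimes> (e \<otimes> (s' \<otimes> e'))"
  proof -
    have "e \<otimes> (s' \<otimes> (c \<otimes> e')) = (e \<otimes> s') \<otimes> c \<otimes> e'"
      using cl by (simp add: m_assoc)
    also have "\<dots> = c \<otimes> (e \<otimes> s') \<otimes> e'"
      using cl center_commute[OF cc, of "e \<otimes> s'"] by simp
    finally show ?thesis using cl by (simp add: m_assoc)
  qed
  have IH: "central_sum R x y (map (apsnd (twisted_commutator s z)) cz) =
     T \<otimes> (s' \<otimes> e) \<ominus> e \<otimes> (s' \<otimes> T)"
    using Cons by (simp add: T_def e_def s'_def)
  have "central_sum R x y (map (apsnd (twisted_commutator s z)) (p # cz)) =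
      c \<otimes> (e' \<otimes> (s' \<otimes> e) \<ominus> e \<otimes> (s' \<otimes> e')) \<oplus> (T \<otimes> (s' \<otimes> e) \<ominus> e \<otimes> (s' \<otimes> T))"
    using xy by (simp add: p central_sum_Cons IH signed_eval_twisted_commutator e_def e'_def s'_def)
  also have "\<dots> = (c \<otimes> e' \<oplus> T) \<otimes> (s' \<otimes> e) \<ominus> e \<otimes> (s' \<otimes> (c \<otimes> e' \<oplus> T))"
    using cl by (simp add: r_distr l_distr a_minus_def comm r_minus m_assoc minus_add a_ac)
  finally show ?case
    by (simp add: p central_sum_Cons e_def e'_def s'_def T_def)
qed

text \<open>
  In one step of the elimination the first summand \<open>c z\<close> of a relation \<open>c z + T = 0\<close> gives
  \<open>T s z - z s T = - c z s z + z s c z = 0\<close>, which is a shorter relation with the same last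
  coefficient. When a single element is left, the relation says that its product with this
  coefficient is zero.
\<close>

theorem capelli_central_dependence:
  assumes xy: "x \<in> carrier R" "y \<in> carrier R"
    and "cz \<noteq> []"
    and "fst ` set cz \<subseteq> ring_center R"
    and "central_sum R x y cz = \<zero>"
  shows "fst (last cz) \<otimes> signed_eval R x y (capelli (map snd cz)) = \<zero>"
  using assms(3-)
proof (induction "length cz" arbitrary: cz rule: less_induct)
  case less
  show ?case
  proof (cases cz)
    case Nil
    then show ?thesis using less.prems by simp
  next
    case c1: (Cons p cz')
    obtain c z where p: "p = (c, z)" by (cases p)
    show ?thesis
    proof (cases cz')
      case Nil
      have "c \<in> carrier R" using less.prems c1 p by (auto simp: center_carrier)
      then show ?thesis using less.prems xy by (simp add: c1 p Nil central_sum_def)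
    next
      case c2: (Cons q cz'')
      define s where "s = separator (total_length (map snd cz))"
      define e where "e = signed_eval R x y z"
      define s' where "s' = word_eval R x y s"
      define T where "T = central_sum R x y cz'"
      have cc: "c \<in> ring_center R" using less.prems p c1 by auto
      have cl: "c \<in> carrier R" "e \<in> carrier R" "s' \<in> carrier R" "T \<in> carrier R"
        using xy less.prems cc c1 by (auto simp: e_def s'_def T_def center_carrier
            intro!: central_sum_closed)
      have "c \<otimes> e \<oplus> T = \<zero>"
        using less.prems by (simp add: c1 p central_sum_Cons e_def T_def)
      then have T: "T = \<ominus> (c \<otimes> e)"
        using cl by (metis a_comm m_closed minus_equality)
      have "e \<otimes> (s' \<otimes> (c \<otimes> e)) = (e \<otimes> s') \<otimes> c \<otimes> e"
        using cl by (simp add: m_assoc)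
      also have "\<dots> = c \<otimes> (e \<otimes> s') \<otimes> e"
        using cl center_commute[OF cc, of "e \<otimes> s'"] by simp
      finally have comm: "e \<otimes> (s' \<otimes> (c \<otimes> e)) = c \<otimes> (e \<otimes> (s' \<otimes> e))"
        using cl by (simp add: m_assoc)
      let ?cz = "map (apsnd (twisted_commutator s z)) cz'"
      have "central_sum R x y ?cz = T \<otimes> (s' \<otimes> e) \<ominus> e \<otimes> (s' \<otimes> T)"
        using central_sum_twisted_commutator[OF xy] less.prems
        by (simp add: c1 T_def s'_def e_def)
      also have "\<dots> = \<zero>"
        using cl by (simp add: T l_minus r_minus comm m_assoc a_minus_def r_neg l_neg)
      finally have 0: "central_sum R x y ?cz = \<zero>" .
      have "fst (last ?cz) \<otimes> signed_eval R x y (capelli (map snd ?cz)) = \<zero>"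
        by (rule less.hyps) (use 0 less.prems c1 c2 in auto)
      moreover have "fst (last ?cz) = fst (last cz)"
        by (simp add: c1 c2 last_map)
      moreover have "capelli (map snd cz) = capelli (map snd ?cz)"
        by (simp add: c1 c2 p s_def comp_def)
      ultimately show ?thesis by simp
    qed
  qed
qed

end

section \<open>The eliminated element has distinct words\<close>

text \<open>
  If \<open>u\<close> were shorter than \<open>v\<close>, the letter \<open>X\<close> that begins the separator after \<open>v\<close> would stand
  inside the block \<open>Y\<^sup>n\<close> after \<open>u\<close>.
\<close>

lemma separator_unique:
  assumes eq: "u @ separator n @ u' = v @ separator n @ v'"
    and len: "length u \<le> n" "length v \<le> n"
  shows "u = v \<and> u' = v'"
proof -
  have le: "length v \<le> length u"
    if eq: "u @ separator n @ u' = v @ separator n @ v'" and "length v \<le> n" for u v u' v' :: "bool list"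
  proof (rule ccontr)
    assume lt: "\<not> length v \<le> length u"
    let ?k = "length v - length u"
    have k: "0 < ?k" "?k \<le> n" using lt that by auto
    \<comment> \<open>Compare the letters at the first position of the later separator.\<close>
    have "(u @ separator n @ u') ! length v = (v @ separator n @ v') ! length v"
      using eq by simp
    moreover have "(v @ separator n @ v') ! length v = True"
      by (simp add: separator_def nth_append)
    moreover have "(u @ separator n @ u') ! length v = False"
      using lt k diff_Suc_less[of "length v - length u" 0]
      by (simp add: nth_append separator_def nth_Cons' less_eq_Suc_le Suc_diff_Suc)
    ultimately show False by simp
  qed
  have "length u = length v"
    using le[OF eq len(2)] le[OF eq[symmetric] len(1)] by simp
  then show ?thesis using eq by simp
qed

lemma words_signed_neg [simp]: "words (signed_neg z) = words z"
  by (auto simp: signed_neg_def)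

lemma words_signed_mult:
  "words (signed_mult z z') = map (\<lambda>(u, u'). u @ u') (List.product (words z) (words z'))"
proof (induction z)
  case Nil
  then show ?case by (simp add: signed_mult_def)
next
  case (Cons p z)
  have "words (signed_mult (p # z) z') = map (\<lambda>w. snd p @ w) (words z') @ words (signed_mult z z')"
    by (cases p) (auto simp: signed_mult_def)
  then show ?case using Cons.IH by (simp add: comp_def)
qed

lemma words_twisted_commutator:
  "words (twisted_commutator s z z') =
    map (\<lambda>(u, u'). u @ s @ u') (List.product (words z') (words z)) @
    map (\<lambda>(u, u'). u @ s @ u') (List.product (words z) (words z'))"
proof -
  have 1: "words (signed_mult [(True, s)] z) = map (\<lambda>u. s @ u) (words z)" for z
    by (auto simp: signed_mult_def)
  have 2: "map (\<lambda>(u, u'). u @ u') (List.product us (map (\<lambda>u. s @ u) vs)) =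
      map (\<lambda>(u, u'). u @ s @ u') (List.product us vs)" for us vs :: "bool list list"
    by (induction us) (simp_all add: comp_def)
  show ?thesis
    by (simp only: twisted_commutator_def map_append words_signed_neg
        words_signed_mult[of _ "signed_mult _ _"] 1 2)
qed

definition words_disjoint :: "signed_words \<Rightarrow> signed_words \<Rightarrow> bool" where
  "words_disjoint z z' \<longleftrightarrow> set (words z) \<inter> set (words z') = {}"

text \<open>
  The invariant of the elimination: no word occurs twice, neither within an element of the family
  nor in two of them. There is then no cancellation, and the elements are visibly nonzero.
\<close>

definition separated :: "signed_words list \<Rightarrow> bool" where
  "separated zs \<longleftrightarrow>
    (\<forall>z \<in> set zs. z \<noteq> [] \<and> distinct (words z)) \<and> sorted_wrt words_disjoint zs"

text \<open>
  A word \<open>u s u'\<close> of the twisted commutator of \<open>z'\<close> with \<open>z\<close> determines \<open>u\<close> and \<open>u'\<close>, hence also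
  which of the two comes from \<open>z\<close> and which from \<open>z'\<close>.
\<close>

lemma separated_twisted_commutator:
  assumes ind: "separated (z # zs)"
    and len: "\<And>w. w \<in> set (concat (map words (z # zs))) \<Longrightarrow> length w \<le> n"
  shows "separated (map (twisted_commutator (separator n) z) zs)"
proof -
  let ?s = "separator n"
  have uniq: "u = v \<and> u' = v'"
    if "u @ ?s @ u' = v @ ?s @ v'" "z1 \<in> set (z # zs)" "z2 \<in> set (z # zs)"
      "u \<in> set (words z1)" "v \<in> set (words z2)" for u v u' v' z1 z2
    using separator_unique[OF that(1)] len that(2-) by auto
  have set_words: "set (words (twisted_commutator ?s z z')) =
      {u @ ?s @ u' | u u'. u \<in> set (words z') \<and> u' \<in> set (words z) \<or>
        u \<in> set (words z) \<and> u' \<in> set (words z')}" for z'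
    unfolding words_twisted_commutator by auto
  have disj: "set (words z) \<inter> set (words z') = {}" if "z' \<in> set zs" for z'
    using ind that by (auto simp: separated_def words_disjoint_def)
  have "distinct (words (twisted_commutator ?s z z'))" if z': "z' \<in> set zs" for z'
  proof -
    have d: "distinct (words z)" "distinct (words z')"
      using ind z' by (auto simp: separated_def)
    have inj: "inj_on (\<lambda>(u, u'). u @ ?s @ u') (set (words z1) \<times> set (words z2))"
      if "z1 \<in> set (z # zs)" for z1 z2
    proof (rule inj_onI, clarify)
      fix u u' v v' assume "u \<in> set (words z1)" "v \<in> set (words z1)" "u @ ?s @ u' = v @ ?s @ v'"
      then show "u = v \<and> u' = v'" using uniq[of u u' v v' z1 z1] that by blast
    qed
    have "distinct (map (\<lambda>(u, u'). u @ ?s @ u') (List.product (words z1) (words z2)))"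
      if "z1 \<in> set (z # zs)" "distinct (words z1)" "distinct (words z2)" for z1 z2
      using inj that by (simp add: distinct_map[of _ "List.product _ _"] distinct_product)
    moreover have "(\<lambda>(u, u'). u @ ?s @ u') ` (set (words z') \<times> set (words z)) \<inter>
        (\<lambda>(u, u'). u @ ?s @ u') ` (set (words z) \<times> set (words z')) = {}"
      (is "?A \<inter> ?B = {}")
    proof -
      have False if A: "w \<in> ?A" and B: "w \<in> ?B" for w
      proof -
        obtain u u' where u: "w = u @ ?s @ u'" "u \<in> set (words z')" using A by auto
        obtain v v' where v: "w = v @ ?s @ v'" "v \<in> set (words z)" using B by auto
        have "u = v \<and> u' = v'" by (rule uniq[of u u' v v' z' z]) (use u v z' in simp_all)
        then show False using u v disj[OF z'] by blast
      qed
      then show ?thesis by blast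
    qed
    ultimately show ?thesis
      using d z' by (simp add: words_twisted_commutator)
  qed
  moreover have "twisted_commutator ?s z z' \<noteq> []" if "z' \<in> set zs" for z'
  proof -
    have "z \<noteq> []" "z' \<noteq> []" using ind that by (auto simp: separated_def)
    then show ?thesis
      by (cases z; cases z') (simp_all add: twisted_commutator_def signed_mult_def)
  qed
  moreover have "sorted_wrt words_disjoint (map (twisted_commutator ?s z) zs)"
  proof -
    have "words_disjoint (twisted_commutator ?s z z1) (twisted_commutator ?s z z2)"
      if "z1 \<in> set zs" "z2 \<in> set zs" "words_disjoint z1 z2" for z1 z2
    proof -
      have "False" if w: "w \<in> set (words (twisted_commutator ?s z z1))"
        "w \<in> set (words (twisted_commutator ?s z z2))" for w
      proof -
        obtain u u' where u: "w = u @ ?s @ u'" "u \<in> set (words z1) \<and> u' \<in> set (words z) \<or>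
            u \<in> set (words z) \<and> u' \<in> set (words z1)"
          using w unfolding set_words by blast
        obtain v v' where v: "w = v @ ?s @ v'" "v \<in> set (words z2) \<and> v' \<in> set (words z) \<or>
            v \<in> set (words z) \<and> v' \<in> set (words z2)"
          using w unfolding set_words by blast
        have "length u \<le> n" "length v \<le> n"
          using u v len \<open>z1 \<in> set zs\<close> \<open>z2 \<in> set zs\<close> by auto
        then have "u = v" "u' = v'" using separator_unique[of u n u' v v'] u v by auto
        then show False
          using u v disj[OF \<open>z1 \<in> set zs\<close>] disj[OF \<open>z2 \<in> set zs\<close>] \<open>words_disjoint z1 z2\<close>
          unfolding words_disjoint_def by blast
      qed
      then show ?thesis by (auto simp: words_disjoint_def)
    qed
    moreover have "sorted_wrt words_disjoint zs" using ind by (simp add: separated_def)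
    ultimately show ?thesis
      unfolding sorted_wrt_map by (blast intro: sorted_wrt_mono_rel)
  qed
  ultimately show ?thesis by (auto simp: separated_def)
qed

lemma length_le_total_length:
  assumes "w \<in> set (concat (map words zs))"
  shows "length w \<le> total_length zs"
proof -
  have "length w \<in> set (map length (concat (map words zs)))" using assms by auto
  then have "length w \<le> sum_list (map length (concat (map words zs)))"
    by (rule member_le_sum_list) simp
  then show ?thesis by (simp add: total_length_def length_concat)
qed

lemma capelli_distinct_words:
  "separated zs \<Longrightarrow> zs \<noteq> [] \<Longrightarrow> capelli zs \<noteq> [] \<and> distinct (words (capelli zs))"
proof (induction zs rule: capelli.induct)
  case (3 z z' zs)
  have "separated (map (twisted_commutator (separator (total_length (z # z' # zs))) z) (z' # zs))"
    by (rule separated_twisted_commutator[OF 3(2)]) (rule length_le_total_length)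
  then show ?case using 3(1) by simp
qed (auto simp: separated_def)

definition capelli_words :: "bool list list \<Rightarrow> signed_words" where
  "capelli_words ws = capelli (map (\<lambda>w. [(True, w)]) ws)"

lemma capelli_words_distinct:
  assumes "distinct ws" "ws \<noteq> []"
  shows "capelli_words ws \<noteq> []" "distinct (words (capelli_words ws))"
proof -
  have "sorted_wrt (\<lambda>w w'. words_disjoint [(True, w)] [(True, w')]) ws"
    using assms(1) by (induction ws) (auto simp: words_disjoint_def)
  then have "separated (map (\<lambda>w. [(True, w)]) ws)"
    by (auto simp: separated_def sorted_wrt_map)
  then show "capelli_words ws \<noteq> []" "distinct (words (capelli_words ws))"
    using capelli_distinct_words[of "map (\<lambda>w. [(True, w)]) ws"] assms(2)
    by (auto simp: capelli_words_def)
qed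

section \<open>Freeness does not depend on the base field\<close>

text \<open>
  The condition that expresses freeness of the pair \<open>x, y\<close> without reference to a base field.
  It consists of countably many inequations, one for each list of words.
\<close>

definition capelli_free :: "('a, 'm) ring_scheme \<Rightarrow> 'a \<Rightarrow> 'a \<Rightarrow> bool" where
  "capelli_free R x y \<longleftrightarrow>
    (\<forall>ws. distinct ws \<longrightarrow> ws \<noteq> [] \<longrightarrow> signed_eval R x y (capelli_words ws) \<noteq> \<zero>\<^bsub>R\<^esub>)"

text \<open>The inequations only involve the ring structure, so embeddings preserve them.\<close>

lemma capelli_free_ring_hom:
  assumes R: "ring R" and S: "ring S" and h: "h \<in> ring_hom R S" and inj: "inj_on h (carrier R)"
    and xy: "x \<in> carrier R" "y \<in> carrier R" and free: "capelli_free R x y"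
  shows "capelli_free S (h x) (h y)"
proof -
  interpret ring_hom_ring R S h using R S h by (rule ring_hom_ringI2)
  have word: "word_eval S (h x) (h y) w = h (word_eval R x y w)" for w
    using xy by (induction w) auto
  have "signed_word_eval S (h x) (h y) p = h (signed_word_eval R x y p)" for p
    using xy by (cases p) (auto simp: word)
  then have eval: "signed_eval S (h x) (h y) z = h (signed_eval R x y z)" for z
    using xy by (induction z) (auto simp: signed_eval_def R.signed_word_eval_image)
  show ?thesis
    unfolding capelli_free_def
  proof (intro allI impI notI)
    fix ws :: "bool list list" assume ws: "distinct ws" "ws \<noteq> []"
      and "signed_eval S (h x) (h y) (capelli_words ws) = \<zero>\<^bsub>S\<^esub>"
    then have "h (signed_eval R x y (capelli_words ws)) = h \<zero>\<^bsub>R\<^esub>" by (simp add: eval)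
    then have "signed_eval R x y (capelli_words ws) = \<zero>\<^bsub>R\<^esub>"
      by (rule inj_onD[OF inj]) (use xy in simp_all)
    then show False using free ws by (simp add: capelli_free_def)
  qed
qed

context ring
begin

lemma free_algebra_eval_superset:
  assumes xy: "x \<in> carrier R" "y \<in> carrier R"
    and f: "range f \<subseteq> carrier R" and A: "finite A" "{w. f w \<noteq> \<zero>} \<subseteq> A"
  shows "free_algebra_eval R x y f = (\<Oplus>w \<in> A. f w \<otimes> word_eval R x y w)"
  unfolding free_algebra_eval_def
  by (rule add.finprod_mono_neutral_cong_left[OF A])
    (use xy f in \<open>auto simp: range_subsetD\<close>)

lemma free_algebra_eval_diff:
  assumes xy: "x \<in> carrier R" "y \<in> carrier R"
    and F: "F \<subseteq> carrier R"
    and fg: "f \<in> free_algebra_carrier R F" "g \<in> free_algebra_carrier R F"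
  shows "free_algebra_eval R x y (\<lambda>w. f w \<ominus> g w) =
    free_algebra_eval R x y f \<ominus> free_algebra_eval R x y g"
proof -
  let ?A = "{w. f w \<noteq> \<zero>} \<union> {w. g w \<noteq> \<zero>}"
  have A: "finite ?A" using fg by (auto simp: free_algebra_carrier_def)
  have cl: "f w \<in> carrier R" "g w \<in> carrier R" for w
    using fg F unfolding free_algebra_carrier_def by blast+
  let ?W = "word_eval R x y"
  have f: "free_algebra_eval R x y f = (\<Oplus>w \<in> ?A. f w \<otimes> ?W w)"
    by (rule free_algebra_eval_superset[OF xy _ A]) (use cl in auto)
  have g: "free_algebra_eval R x y g = (\<Oplus>w \<in> ?A. g w \<otimes> ?W w)"
    by (rule free_algebra_eval_superset[OF xy _ A]) (use cl in auto)
  have "w \<in> ?A" if "f w \<ominus> g w \<noteq> \<zero>" for w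
  proof (rule ccontr)
    assume "w \<notin> ?A"
    then show False using that by (simp add: a_minus_def)
  qed
  then have h: "free_algebra_eval R x y (\<lambda>w. f w \<ominus> g w) = (\<Oplus>w \<in> ?A. (f w \<ominus> g w) \<otimes> ?W w)"
    by (intro free_algebra_eval_superset[OF xy _ A]) (use cl in auto)
  have "(f w \<ominus> g w) \<otimes> ?W w \<oplus> g w \<otimes> ?W w = f w \<otimes> ?W w" for w
    using cl[of w] xy by (simp add: l_distr a_minus_def a_assoc l_minus l_neg)
  then have *: "free_algebra_eval R x y (\<lambda>w. f w \<ominus> g w) \<oplus> free_algebra_eval R x y g =
      free_algebra_eval R x y f"
    unfolding f g h by (subst finsum_addf[symmetric]) (use cl xy in auto)
  have "free_algebra_eval R x y h \<in> carrier R" if "range h \<subseteq> carrier R" for h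
    unfolding free_algebra_eval_def using that xy by (intro finsum_closed) (auto simp: range_subsetD)
  then have "free_algebra_eval R x y (\<lambda>w. f w \<ominus> g w) \<in> carrier R"
    "free_algebra_eval R x y g \<in> carrier R"
    using cl by (simp_all add: image_subset_iff)
  then have "(free_algebra_eval R x y (\<lambda>w. f w \<ominus> g w) \<oplus>
        free_algebra_eval R x y g) \<ominus> free_algebra_eval R x y g =
      free_algebra_eval R x y (\<lambda>w. f w \<ominus> g w)"
    by (simp only: a_minus_def a_assoc r_neg a_inv_closed r_zero)
  then show ?thesis unfolding * by (rule sym)
qed

end

context skew_field
begin

lemma Units_iff: "a \<in> Units R \<longleftrightarrow> a \<in> carrier R \<and> a \<noteq> \<zero>"
  using skew_field_Units by auto

lemma inv_closed [simp]: "a \<in> carrier R \<Longrightarrow> a \<noteq> \<zero> \<Longrightarrow> inv a \<in> carrier R"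
  using Units_iff by blast

lemma l_inv [simp]: "a \<in> carrier R \<Longrightarrow> a \<noteq> \<zero> \<Longrightarrow> inv a \<otimes> a = \<one>"
  and r_inv [simp]: "a \<in> carrier R \<Longrightarrow> a \<noteq> \<zero> \<Longrightarrow> a \<otimes> inv a = \<one>"
  using Units_iff Units_l_inv Units_r_inv by blast+

lemma mult_eq_zero_iff:
  assumes "a \<in> carrier R" "b \<in> carrier R"
  shows "a \<otimes> b = \<zero> \<longleftrightarrow> a = \<zero> \<or> b = \<zero>"
proof
  assume 0: "a \<otimes> b = \<zero>"
  show "a = \<zero> \<or> b = \<zero>"
  proof (rule disjCI)
    assume "b \<noteq> \<zero>"
    then have "a = a \<otimes> b \<otimes> inv b" using assms by (simp add: m_assoc)
    then show "a = \<zero>" using assms \<open>b \<noteq> \<zero>\<close> by (simp add: 0)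
  qed
qed (use assms in auto)

text \<open>
  As the words of \<open>z\<close> are distinct, the list \<open>z\<close> is itself the support of an element \<open>f\<close> of the
  free algebra with coefficients \<open>1\<close> and \<open>-1\<close>, and \<open>f\<close> has the same value as \<open>z\<close>.
\<close>

lemma signed_eval_nonzero_if_free:
  assumes xy: "x \<in> carrier R" "y \<in> carrier R"
    and F: "{\<zero>, \<one>, \<ominus> \<one>} \<subseteq> F" "F \<subseteq> carrier R"
    and inj: "inj_on (free_algebra_eval R x y) (free_algebra_carrier R F)"
    and z: "z \<noteq> []" "distinct (words z)"
  shows "signed_eval R x y z \<noteq> \<zero>"
proof
  assume 0: "signed_eval R x y z = \<zero>"
  define f where "f w = (if w \<in> set (words z) then
      if (True, w) \<in> set z then \<one> else \<ominus> \<one> else \<zero>)" for w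
  have one: "\<ominus> \<one> \<noteq> \<zero>" using one_not_zero by (metis minus_zero minus_minus one_closed)
  have supp: "{w. f w \<noteq> \<zero>} = set (words z)"
    using one one_not_zero by (auto simp: f_def)
  have f: "f \<in> free_algebra_carrier R F"
    using F supp by (auto simp: free_algebra_carrier_def f_def)
  have val: "signed_word_eval R x y p = f (snd p) \<otimes> word_eval R x y (snd p)" if "p \<in> set z" for p
  proof -
    obtain b w where p: "p = (b, w)" by (cases p)
    have "b" if "(True, w) \<in> set z"
      using z(2) that \<open>p \<in> set z\<close> p unfolding distinct_map inj_on_def
      by (metis prod.inject snd_conv)
    moreover have "\<not> b" if "(True, w) \<notin> set z"
      using that \<open>p \<in> set z\<close> p by (cases b) auto
    moreover have "w \<in> set (words z)" using \<open>p \<in> set z\<close> p by force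
    ultimately show ?thesis using xy by (auto simp: p f_def l_minus)
  qed
  have "signed_eval R x y z = list_sum R (map (\<lambda>w. f w \<otimes> word_eval R x y w) (words z))"
    using val by (simp add: signed_eval_def comp_def cong: map_cong)
  also have "\<dots> = free_algebra_eval R x y f"
    unfolding free_algebra_eval_def supp
    by (rule list_sum_distinct[OF z(2)]) (use xy in \<open>auto simp: f_def\<close>)
  finally have "free_algebra_eval R x y f = \<zero>" using 0 by simp
  moreover have "free_algebra_eval R x y (\<lambda>_. \<zero>) = \<zero>"
    by (simp add: free_algebra_eval_def)
  moreover have "(\<lambda>_. \<zero>) \<in> free_algebra_carrier R F"
    using F by (auto simp: free_algebra_carrier_def)
  ultimately have "f = (\<lambda>_. \<zero>)" using inj_onD[OF inj _ f] by metis
  then show False using supp z(1) by simp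
qed

text \<open>
  If two elements of the free algebra have the same value, their difference is a relation with
  nonzero central coefficients between the words of its support, so the element that results from
  eliminating these words evaluates to zero. Conversely, such elements are combinations of distinct
  words with coefficients in \<open>F\<close>, so freeness over \<open>F\<close> makes them nonzero.
\<close>

theorem free_iff_capelli_free:
  assumes xy: "x \<in> carrier R" "y \<in> carrier R"
    and F: "{\<zero>, \<one>, \<ominus> \<one>} \<subseteq> F" "F \<subseteq> ring_center R"
  shows "inj_on (free_algebra_eval R x y) (free_algebra_carrier R F) \<longleftrightarrow> capelli_free R x y"
proof
  have Fc: "F \<subseteq> carrier R" using F by (auto dest: center_carrier)
  {
    assume inj: "inj_on (free_algebra_eval R x y) (free_algebra_carrier R F)"
    show "capelli_free R x y"
      using signed_eval_nonzero_if_free[OF xy F(1) Fc inj] capelli_words_distinct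
      by (auto simp: capelli_free_def)
  }
  assume free: "capelli_free R x y"
  show "inj_on (free_algebra_eval R x y) (free_algebra_carrier R F)"
  proof (rule inj_onI, rule ccontr)
    fix f g assume fg: "f \<in> free_algebra_carrier R F" "g \<in> free_algebra_carrier R F"
      and eq: "free_algebra_eval R x y f = free_algebra_eval R x y g" and "f \<noteq> g"
    define h where "h w = f w \<ominus> g w" for w
    have fgF: "f w \<in> F" "g w \<in> F" for w
      using fg by (auto simp: free_algebra_carrier_def)
    then have h_center: "h w \<in> ring_center R" for w
      unfolding h_def using F by (blast intro: center_diff)
    have gc: "g w \<in> carrier R" for w using fgF(2)[of w] Fc by blast
    have hc: "h w \<in> carrier R" for w using h_center[of w] by (rule center_carrier)
    have h0: "h w = \<zero> \<longleftrightarrow> f w = g w" for w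
      using fgF[of w] Fc unfolding h_def by (intro r_right_minus_eq) auto
    have "{w. h w \<noteq> \<zero>} \<subseteq> {w. f w \<noteq> \<zero>} \<union> {w. g w \<noteq> \<zero>}"
    proof
      fix w assume "w \<in> {w. h w \<noteq> \<zero>}"
      then have "f w \<noteq> g w" using h0[of w] by simp
      then show "w \<in> {w. f w \<noteq> \<zero>} \<union> {w. g w \<noteq> \<zero>}" by auto
    qed
    then have "finite {w. h w \<noteq> \<zero>}"
      by (rule finite_subset) (use fg in \<open>simp add: free_algebra_carrier_def\<close>)
    then obtain ws where ws: "set ws = {w. h w \<noteq> \<zero>}" "distinct ws"
      using finite_distinct_list by blast
    obtain w where "f w \<noteq> g w" using \<open>f \<noteq> g\<close> by auto
    then have "w \<in> set ws" unfolding ws(1) using h0[of w] by simp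
    then have "ws \<noteq> []" by auto
    \<comment> \<open>All coefficients of this relation are nonzero; the last one is the one that counts.\<close>
    define cz where "cz = map (\<lambda>w. (h w, [(True, w)])) ws"
    have "free_algebra_eval R x y h = \<zero>"
    proof -
      have "free_algebra_eval R x y g \<in> carrier R"
        unfolding free_algebra_eval_def using gc xy by (intro finsum_closed) simp
      then show ?thesis
        unfolding h_def using free_algebra_eval_diff[OF xy Fc fg] eq by (simp add: a_minus_def r_neg)
    qed
    moreover have "central_sum R x y cz = list_sum R (map (\<lambda>w. h w \<otimes> word_eval R x y w) ws)"
      using signed_eval_single[OF xy] by (simp add: central_sum_def cz_def comp_def)
    moreover have "\<dots> = free_algebra_eval R x y h"
      unfolding free_algebra_eval_def ws(1)[symmetric]
      by (rule list_sum_distinct[OF ws(2)]) (use xy hc in simp)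
    ultimately have "central_sum R x y cz = \<zero>" by simp
    then have "fst (last cz) \<otimes> signed_eval R x y (capelli (map snd cz)) = \<zero>"
      by (intro capelli_central_dependence[OF xy]) (use h_center \<open>ws \<noteq> []\<close> in \<open>auto simp: cz_def\<close>)
    then have "h (last ws) \<otimes> signed_eval R x y (capelli_words ws) = \<zero>"
      using \<open>ws \<noteq> []\<close> by (simp add: cz_def last_map comp_def capelli_words_def)
    then have "h (last ws) = \<zero> \<or> signed_eval R x y (capelli_words ws) = \<zero>"
      using xy hc by (simp add: mult_eq_zero_iff)
    moreover have "h (last ws) \<noteq> \<zero>" using ws(1) last_in_set[OF \<open>ws \<noteq> []\<close>] by simp
    ultimately show False
      using free ws(2) \<open>ws \<noteq> []\<close> by (simp add: capelli_free_def)
  qed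
qed

corollary contains_free_algebra_iff:
  assumes "{\<zero>, \<one>, \<ominus> \<one>} \<subseteq> F" "F \<subseteq> ring_center R"
  shows "contains_free_algebra R F \<longleftrightarrow> (\<exists>x \<in> carrier R. \<exists>y \<in> carrier R. capelli_free R x y)"
  using free_iff_capelli_free[OF _ _ assms] by (auto simp: contains_free_algebra_def)

end

section \<open>Evaluation of polynomials at central elements\<close>

text \<open>
  The value \<open>p(a)\<close> is the remainder of \<open>p\<close> on division by \<open>t - a\<close>. For central \<open>a\<close> the factor
  \<open>t - a\<close> commutes with the constants, so that sums and products of remainders are remainders of
  sums and products; this makes evaluation a ring homomorphism although the coefficients
  do not commute.
\<close>

definition eval_at :: "('a, 'm) ring_scheme \<Rightarrow> 'a \<Rightarrow> (nat \<Rightarrow> 'a) \<Rightarrow> 'a" where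
  "eval_at R a p = (THE d. d \<in> carrier R \<and>
    (\<exists>q \<in> carrier (UP R). p = monom (UP R) d 0 \<oplus>\<^bsub>UP R\<^esub>
      q \<otimes>\<^bsub>UP R\<^esub> (monom (UP R) \<one>\<^bsub>R\<^esub> 1 \<oplus>\<^bsub>UP R\<^esub> monom (UP R) (\<ominus>\<^bsub>R\<^esub> a) 0)))"

context UP_ring
begin

abbreviation linear_factor :: "'a \<Rightarrow> nat \<Rightarrow> 'a" where
  "linear_factor a \<equiv> monom P \<one> 1 \<oplus>\<^bsub>P\<^esub> monom P (\<ominus> a) 0"

definition remainder_at :: "'a \<Rightarrow> (nat \<Rightarrow> 'a) \<Rightarrow> 'a \<Rightarrow> bool" where
  "remainder_at a p d \<longleftrightarrow> d \<in> carrier R \<and>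
    (\<exists>q \<in> carrier P. p = monom P d 0 \<oplus>\<^bsub>P\<^esub> q \<otimes>\<^bsub>P\<^esub> linear_factor a)"

lemma eval_at_eq_remainder: "eval_at R a p = (THE d. remainder_at a p d)"
  by (simp add: eval_at_def remainder_at_def P_def)

lemma linear_factor_closed [simp]: "a \<in> carrier R \<Longrightarrow> linear_factor a \<in> carrier P"
  by simp

lemma coeff_times_linear_factor:
  assumes a: "a \<in> carrier R" and q: "q \<in> carrier P"
  shows "coeff P (q \<otimes>\<^bsub>P\<^esub> linear_factor a) (Suc n) =
    coeff P q n \<ominus> coeff P q (Suc n) \<otimes> a"
proof -
  have "coeff P (q \<otimes>\<^bsub>P\<^esub> monom P \<one> 1) (Suc n) =
      (\<Oplus>i \<in> {..Suc n}. if n = i then coeff P q i else \<zero>)"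
  proof -
    have "coeff P q i \<otimes> coeff P (monom P \<one> 1) (Suc n - i) = (if n = i then coeff P q i else \<zero>)"
      if "i \<le> Suc n" for i
      using q that by (auto simp: Suc_diff_le)
    then show ?thesis
      unfolding coeff_mult[OF q monom_closed[OF R.one_closed]]
      by (intro R.finsum_cong') (use q in auto)
  qed
  also have "\<dots> = coeff P q n"
    using q by (intro R.finsum_singleton) auto
  finally have 1: "coeff P (q \<otimes>\<^bsub>P\<^esub> monom P \<one> 1) (Suc n) = coeff P q n" .
  have "coeff P (q \<otimes>\<^bsub>P\<^esub> monom P (\<ominus> a) 0) (Suc n) =
      (\<Oplus>i \<in> {..Suc n}. if Suc n = i then coeff P q i \<otimes> \<ominus> a else \<zero>)"
  proof -
    have "coeff P q i \<otimes> coeff P (monom P (\<ominus> a) 0) (Suc n - i) =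
        (if Suc n = i then coeff P q i \<otimes> \<ominus> a else \<zero>)"
      if "i \<le> Suc n" for i
      using q a that by auto
    then show ?thesis
      unfolding coeff_mult[OF q monom_closed[OF R.a_inv_closed[OF a]]]
      by (intro R.finsum_cong') (use q a in auto)
  qed
  also have "\<dots> = coeff P q (Suc n) \<otimes> \<ominus> a"
    using q a by (intro R.finsum_singleton) auto
  finally have 2: "coeff P (q \<otimes>\<^bsub>P\<^esub> monom P (\<ominus> a) 0) (Suc n) =
    coeff P q (Suc n) \<otimes> \<ominus> a" .
  have "q \<otimes>\<^bsub>P\<^esub> linear_factor a =
      q \<otimes>\<^bsub>P\<^esub> monom P \<one> 1 \<oplus>\<^bsub>P\<^esub> q \<otimes>\<^bsub>P\<^esub> monom P (\<ominus> a) 0"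
    using q a by (intro P.r_distr) auto
  then have "coeff P (q \<otimes>\<^bsub>P\<^esub> linear_factor a) (Suc n) =
      coeff P (q \<otimes>\<^bsub>P\<^esub> monom P \<one> 1) (Suc n) \<oplus>
      coeff P (q \<otimes>\<^bsub>P\<^esub> monom P (\<ominus> a) 0) (Suc n)"
    using q a by (simp del: coeff_mult)
  then show ?thesis
    using q a by (simp only: 1 2) (simp add: R.r_minus a_minus_def)
qed

text \<open>
  The hypothesis says \<open>q\<^sub>n = q\<^sub>n\<^sub>+\<^sub>1 a\<close> for all \<open>n \<ge> N\<close>. Since \<open>q\<^sub>n\<close> is zero for large \<open>n\<close>, it is zero
  for all \<open>n \<ge> N\<close>. This replaces the degree formula, both for the uniqueness of remainders
  (\<open>N = 0\<close>) and for the drop of the degree when a root is split off.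
\<close>

lemma coeff_zero_if_times_linear_factor:
  assumes a: "a \<in> carrier R" and q: "q \<in> carrier P"
    and 0: "\<And>n. n \<ge> N \<Longrightarrow> coeff P (q \<otimes>\<^bsub>P\<^esub> linear_factor a) (Suc n) = \<zero>"
    and n: "n \<ge> N"
  shows "coeff P q n = \<zero>"
proof -
  obtain m where m: "\<And>i. i > m \<Longrightarrow> coeff P q i = \<zero>"
    using deg_aboveD[OF _ q] by blast
  have "n \<ge> N \<Longrightarrow> coeff P q n = \<zero>" if "n \<le> Suc m" for n
    using that
  proof (induction n rule: inc_induct)
    case base
    then show ?case using m by simp
  next
    case (step n)
    have "coeff P q n \<ominus> coeff P q (Suc n) \<otimes> a = \<zero>"
      using 0[of n] step.prems coeff_times_linear_factor[OF a q, of n] by simp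
    then show ?case using step.IH step.prems a q by (simp add: a_minus_def)
  qed
  then show ?thesis using n m[of n] by (cases "n \<le> Suc m") auto
qed

lemma remainder_at_unique:
  assumes a: "a \<in> carrier R" and d: "remainder_at a p d" "remainder_at a p d'"
  shows "d = d'"
proof -
  obtain q q' where q: "q \<in> carrier P" "q' \<in> carrier P"
    and p: "p = monom P d 0 \<oplus>\<^bsub>P\<^esub> q \<otimes>\<^bsub>P\<^esub> linear_factor a"
      "p = monom P d' 0 \<oplus>\<^bsub>P\<^esub> q' \<otimes>\<^bsub>P\<^esub> linear_factor a"
    and dc: "d \<in> carrier R" "d' \<in> carrier R"
    using d by (auto simp: remainder_at_def)
  define r where "r = q \<ominus>\<^bsub>P\<^esub> q'"
  define b b' L where "b = monom P d 0" "b' = monom P d' 0" "L = linear_factor a"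
  have cl: "b \<in> carrier P" "b' \<in> carrier P" "L \<in> carrier P" "r \<in> carrier P"
    using a dc q unfolding b_b'_L_def r_def by auto
  have "b \<oplus>\<^bsub>P\<^esub> q \<otimes>\<^bsub>P\<^esub> L = b' \<oplus>\<^bsub>P\<^esub> q' \<otimes>\<^bsub>P\<^esub> L"
    using p unfolding b_b'_L_def by simp
  moreover have "b \<oplus>\<^bsub>P\<^esub> r \<otimes>\<^bsub>P\<^esub> L = (b \<oplus>\<^bsub>P\<^esub> q \<otimes>\<^bsub>P\<^esub> L) \<ominus>\<^bsub>P\<^esub> q' \<otimes>\<^bsub>P\<^esub> L"
    using q cl unfolding r_def
    by (simp add: P.l_distr a_minus_def P.l_minus P.a_assoc del: UP_a_assoc)
  ultimately have "b \<oplus>\<^bsub>P\<^esub> r \<otimes>\<^bsub>P\<^esub> L = b'"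
    using q cl by (simp add: a_minus_def P.a_assoc P.r_neg)
  then have eq: "r \<otimes>\<^bsub>P\<^esub> L = b' \<ominus>\<^bsub>P\<^esub> b"
    using q cl by (metis P.minus_eq P.a_comm P.add.inv_solve_right P.m_closed)
  have "coeff P (r \<otimes>\<^bsub>P\<^esub> L) (Suc n) = \<zero>" for n
    unfolding eq using dc by (simp add: a_minus_def b_b'_L_def)
  then have "coeff P r n = \<zero>" for n
    using coeff_zero_if_times_linear_factor[OF a cl(4), of 0 n] by (simp add: b_b'_L_def)
  then have "r = \<zero>\<^bsub>P\<^esub>" using cl by (intro up_eqI) auto
  then have "b' = b" using eq cl by (metis P.l_null P.r_right_minus_eq)
  then show ?thesis using dc monom_inj[of 0] unfolding b_b'_L_def by (auto dest: inj_onD)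
qed

lemma remainder_at_add:
  assumes a: "a \<in> carrier R" and "remainder_at a p d" "remainder_at a p' d'"
  shows "remainder_at a (p \<oplus>\<^bsub>P\<^esub> p') (d \<oplus> d')"
proof -
  obtain q q' where q: "q \<in> carrier P" "q' \<in> carrier P"
    and p: "p = monom P d 0 \<oplus>\<^bsub>P\<^esub> q \<otimes>\<^bsub>P\<^esub> linear_factor a"
      "p' = monom P d' 0 \<oplus>\<^bsub>P\<^esub> q' \<otimes>\<^bsub>P\<^esub> linear_factor a"
    and dc: "d \<in> carrier R" "d' \<in> carrier R"
    using assms by (auto simp: remainder_at_def)
  have "p \<oplus>\<^bsub>P\<^esub> p' = monom P (d \<oplus> d') 0 \<oplus>\<^bsub>P\<^esub> (q \<oplus>\<^bsub>P\<^esub> q') \<otimes>\<^bsub>P\<^esub> linear_factor a"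
    using linear_factor_closed[OF a] q dc unfolding p
    by (simp add: P.l_distr P.a_ac del: linear_factor_closed)
  then show ?thesis using q dc by (auto simp: remainder_at_def)
qed

lemma linear_factor_commute:
  assumes a: "a \<in> ring_center R" and d: "d \<in> carrier R"
  shows "linear_factor a \<otimes>\<^bsub>P\<^esub> monom P d 0 = monom P d 0 \<otimes>\<^bsub>P\<^esub> linear_factor a"
proof -
  have "monom P (b \<otimes> c) (n + m) = monom P b n \<otimes>\<^bsub>P\<^esub> monom P c m"
    if "b \<in> carrier R" "c \<in> carrier R" for b c n m
    using that by simp
  moreover have "\<ominus> a \<otimes> d = d \<otimes> \<ominus> a" "a \<in> carrier R"
    using R.center_commute[OF a d] R.center_carrier[OF a] d by (simp_all add: R.l_minus R.r_minus)
  ultimately show ?thesis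
    using d by (simp add: P.l_distr P.r_distr del: monom_mult monom_a_inv flip: monom_mult)
qed

lemma remainder_at_mult:
  assumes a: "a \<in> ring_center R" and "remainder_at a p d" "remainder_at a p' d'"
  shows "remainder_at a (p \<otimes>\<^bsub>P\<^esub> p') (d \<otimes> d')"
proof -
  define L where "L = linear_factor a"
  have L: "L \<in> carrier P" unfolding L_def using R.center_carrier[OF a] by simp
  obtain q q' where q: "q \<in> carrier P" "q' \<in> carrier P"
    and p: "p = monom P d 0 \<oplus>\<^bsub>P\<^esub> q \<otimes>\<^bsub>P\<^esub> L"
      "p' = monom P d' 0 \<oplus>\<^bsub>P\<^esub> q' \<otimes>\<^bsub>P\<^esub> L"
    and dc: "d \<in> carrier R" "d' \<in> carrier R"
    using assms by (auto simp: remainder_at_def L_def)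
  define b b' where "b = monom P d 0" "b' = monom P d' 0"
  have b: "b \<in> carrier P" "b' \<in> carrier P" using dc by (auto simp: b_b'_def)
  have "L \<otimes>\<^bsub>P\<^esub> b' = b' \<otimes>\<^bsub>P\<^esub> L"
    using linear_factor_commute[OF a dc(2)] by (simp add: L_def b_b'_def)
  then have "p \<otimes>\<^bsub>P\<^esub> p' = b \<otimes>\<^bsub>P\<^esub> b' \<oplus>\<^bsub>P\<^esub>
      (b \<otimes>\<^bsub>P\<^esub> q' \<oplus>\<^bsub>P\<^esub> q \<otimes>\<^bsub>P\<^esub> b' \<oplus>\<^bsub>P\<^esub> q \<otimes>\<^bsub>P\<^esub> L \<otimes>\<^bsub>P\<^esub> q') \<otimes>\<^bsub>P\<^esub> L"
    using L q b unfolding p b_b'_def[symmetric]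
    by (simp add: P.l_distr P.r_distr P.m_assoc P.a_ac)
  moreover have "b \<otimes>\<^bsub>P\<^esub> b' = monom P (d \<otimes> d') 0"
    using dc monom_mult[of d d' 0 0] by (simp add: b_b'_def)
  ultimately show ?thesis
    using q b L dc unfolding remainder_at_def L_def[symmetric]
    by (intro conjI
        bexI[of _ "b \<otimes>\<^bsub>P\<^esub> q' \<oplus>\<^bsub>P\<^esub> q \<otimes>\<^bsub>P\<^esub> b' \<oplus>\<^bsub>P\<^esub> q \<otimes>\<^bsub>P\<^esub> L \<otimes>\<^bsub>P\<^esub> q'"]) simp_all
qed

lemma remainder_at_const:
  assumes "a \<in> carrier R" "d \<in> carrier R"
  shows "remainder_at a (monom P d 0) d"
  unfolding remainder_at_def
  using assms linear_factor_closed[OF assms(1)]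
  by (intro conjI bexI[of _ "\<zero>\<^bsub>P\<^esub>"]) (simp_all del: linear_factor_closed)

lemma remainder_at_indeterminate:
  assumes a: "a \<in> carrier R"
  shows "remainder_at a (monom P \<one> 1) a"
proof -
  have "monom P a 0 \<oplus>\<^bsub>P\<^esub> linear_factor a = monom P \<one> 1"
    using a by (intro up_eqI) (auto simp: R.r_neg)
  then show ?thesis
    unfolding remainder_at_def using a linear_factor_closed[OF a]
    by (intro conjI bexI[of _ "\<one>\<^bsub>P\<^esub>"]) (simp_all del: linear_factor_closed)
qed

text \<open>
  Polynomials are generated by the constants and \<open>t\<close>, whose remainders are the constants
  themselves and \<open>a\<close>.
\<close>

lemma remainder_at_exists:
  assumes a: "a \<in> ring_center R" and p: "p \<in> carrier P"
  shows "\<exists>d. remainder_at a p d"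
proof -
  have ac: "a \<in> carrier R" using a by (rule R.center_carrier)
  have monom: "\<exists>d. remainder_at a (monom P b n) d" if "b \<in> carrier R" for b n
  proof (induction n)
    case 0
    then show ?case using remainder_at_const[OF ac that] by blast
  next
    case (Suc n)
    then obtain d where "remainder_at a (monom P b n) d" ..
    moreover have "monom P b (Suc n) = monom P b n \<otimes>\<^bsub>P\<^esub> monom P \<one> 1"
      using that monom_mult[of b \<one> n 1] by simp
    ultimately show ?case
      using remainder_at_mult[OF a _ remainder_at_indeterminate[OF ac]] by auto
  qed
  have "\<exists>d. remainder_at a (\<Oplus>\<^bsub>P\<^esub>i \<in> {..n}. monom P (coeff P p i) i) d" for n
  proof (induction n)
    case 0
    then show ?case using monom[of _ 0] p by simp
  next
    case (Suc n)
    then show ?case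
      using monom[of "coeff P p (Suc n)" "Suc n"] p remainder_at_add[OF ac]
      by (simp add: Pi_def) blast
  qed
  then show ?thesis using up_repr[OF p] by metis
qed

lemma eval_at_eqI: "a \<in> carrier R \<Longrightarrow> remainder_at a p d \<Longrightarrow> eval_at R a p = d"
  unfolding eval_at_eq_remainder using remainder_at_unique by blast

lemma remainder_at_eval_at:
  assumes "a \<in> ring_center R" "p \<in> carrier P"
  shows "remainder_at a p (eval_at R a p)"
  using remainder_at_exists[OF assms] eval_at_eqI R.center_carrier[OF assms(1)] by blast

lemma eval_at_const: "a \<in> carrier R \<Longrightarrow> d \<in> carrier R \<Longrightarrow> eval_at R a (monom P d 0) = d"
  by (intro eval_at_eqI remainder_at_const)

lemma eval_at_ring_hom:
  assumes a: "a \<in> ring_center R"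
  shows "eval_at R a \<in> ring_hom P R"
proof (rule ring_hom_memI)
  have ac: "a \<in> carrier R" using a by (rule R.center_carrier)
  fix p q assume pq: "p \<in> carrier P" "q \<in> carrier P"
  note rem = remainder_at_eval_at[OF a pq(1)] remainder_at_eval_at[OF a pq(2)]
  show "eval_at R a p \<in> carrier R" using rem by (simp add: remainder_at_def)
  show "eval_at R a (p \<otimes>\<^bsub>P\<^esub> q) = eval_at R a p \<otimes> eval_at R a q"
    by (intro eval_at_eqI[OF ac] remainder_at_mult[OF a] rem)
  show "eval_at R a (p \<oplus>\<^bsub>P\<^esub> q) = eval_at R a p \<oplus> eval_at R a q"
    by (intro eval_at_eqI[OF ac] remainder_at_add[OF ac] rem)
next
  show "eval_at R a \<one>\<^bsub>P\<^esub> = \<one>"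
    using eval_at_const[of a \<one>] R.center_carrier[OF a] monom_one by simp
qed

lemma eval_at_linear_factor:
  assumes "a \<in> carrier R" "b \<in> carrier R"
  shows "eval_at R b (linear_factor a) = b \<ominus> a"
  unfolding a_minus_def using assms
  by (intro eval_at_eqI remainder_at_add remainder_at_indeterminate remainder_at_const) auto

end

text \<open>
  A polynomial may have infinitely many roots in a division ring, but its central roots can be
  split off one by one: if \<open>p = q (t - a)\<close>, then a central root \<open>b\<close> of \<open>p\<close> satisfies
  \<open>q(b) (b - a) = 0\<close>, so \<open>b = a\<close> or \<open>b\<close> is a root of \<open>q\<close>.
\<close>

lemma (in skew_field) finite_central_roots:
  assumes K: "K \<subseteq> ring_center R" and p: "p \<in> carrier (UP R)" "p \<noteq> \<zero>\<^bsub>UP R\<^esub>"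
  shows "finite {a \<in> K. eval_at R a p = \<zero>}"
proof -
  have Kc: "K \<subseteq> carrier R" using K center_carrier by blast
  interpret UP_ring R "UP R" by unfold_locales
  obtain N where "\<forall>n\<ge>N. coeff (UP R) p n = \<zero>"
    using deg_aboveD[OF _ p(1)] by (metis Suc_le_eq)
  then show ?thesis using p
  proof (induction N arbitrary: p)
    case 0
    then have "p = \<zero>\<^bsub>UP R\<^esub>" by (intro up_eqI) auto
    then show ?case using 0 by simp
  next
    case (Suc N)
    show ?case
    proof (cases "\<exists>a \<in> K. eval_at R a p = \<zero>")
      case False
      then have empty: "{a \<in> K. eval_at R a p = \<zero>} = {}" by blast
      show ?thesis unfolding empty by simp
    next
      case True
      then obtain a where a: "a \<in> K" "eval_at R a p = \<zero>" by blast
      have ac: "a \<in> ring_center R" "a \<in> carrier R" using K Kc a by auto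
      have "remainder_at a p \<zero>" using remainder_at_eval_at[OF ac(1) Suc.prems(2)] a by simp
      then obtain q where q: "q \<in> carrier (UP R)" and
        "p = monom (UP R) \<zero> 0 \<oplus>\<^bsub>UP R\<^esub> q \<otimes>\<^bsub>UP R\<^esub> linear_factor a"
        by (auto simp: remainder_at_def)
      then have p: "p = q \<otimes>\<^bsub>UP R\<^esub> linear_factor a"
        using linear_factor_closed[OF ac(2)] by (simp del: linear_factor_closed)
      have "\<forall>n\<ge>N. coeff (UP R) q n = \<zero>"
      proof (intro allI impI)
        fix n assume "n \<ge> N"
        then show "coeff (UP R) q n = \<zero>"
          by (rule coeff_zero_if_times_linear_factor[OF ac(2) q, rotated])
            (use Suc.prems(1) in \<open>simp only: p[symmetric] Suc_le_mono\<close>)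
      qed
      moreover have "q \<noteq> \<zero>\<^bsub>UP R\<^esub>"
        using Suc.prems(3) p linear_factor_closed[OF ac(2)] by auto
      ultimately have "finite {b \<in> K. eval_at R b q = \<zero>}" using Suc.IH q by blast
      moreover have "{b \<in> K. eval_at R b p = \<zero>} \<subseteq> insert a {b \<in> K. eval_at R b q = \<zero>}"
      proof
        fix b assume "b \<in> {b \<in> K. eval_at R b p = \<zero>}"
        then have b: "b \<in> K" "eval_at R b p = \<zero>" by auto
        have bc: "b \<in> ring_center R" "b \<in> carrier R" using K Kc b by auto
        note hom = eval_at_ring_hom[OF bc(1)]
        have "eval_at R b q \<otimes> (b \<ominus> a) = \<zero>"
          using b(2) ring_hom_mult[OF hom q linear_factor_closed[OF ac(2)]]
            eval_at_linear_factor[OF ac(2) bc(2)] p by simp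
        then show "b \<in> insert a {b \<in> K. eval_at R b q = \<zero>}"
          using b(1) ring_hom_closed[OF hom q] ac bc by (auto simp: mult_eq_zero_iff)
      qed
      ultimately show ?thesis by (meson finite_insert finite_subset)
    qed
  qed
qed

section \<open>Fractions of polynomials and central elements\<close>

context skew_field
begin

lemma commute_inv:
  assumes "a \<in> carrier R" "b \<in> carrier R" "b \<noteq> \<zero>" and comm: "a \<otimes> b = b \<otimes> a"
  shows "a \<otimes> inv b = inv b \<otimes> a"
proof -
  have "a \<otimes> inv b = inv b \<otimes> (b \<otimes> a) \<otimes> inv b"
    using assms(1-3) by (simp add: m_assoc[symmetric])
  also have "\<dots> = inv b \<otimes> (a \<otimes> b) \<otimes> inv b" by (simp only: comm)
  also have "\<dots> = inv b \<otimes> a" using assms(1-3) by (simp add: m_assoc)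
  finally show ?thesis .
qed

lemma center_inv:
  assumes "a \<in> ring_center R" "a \<noteq> \<zero>"
  shows "inv a \<in> ring_center R"
  using assms commute_inv[of _ a] by (auto simp: ring_center_def)

end

lemma (in UP_ring) central_coeffs_imp_central:
  assumes p: "p \<in> carrier P" and c: "\<And>n. coeff P p n \<in> ring_center R"
  shows "p \<in> ring_center P"
proof -
  have "p \<otimes>\<^bsub>P\<^esub> q = q \<otimes>\<^bsub>P\<^esub> p" if q: "q \<in> carrier P" for q
  proof (rule up_eqI)
    fix n
    have img: "(\<lambda>i::nat. n - i) ` {..n} = {..n}"
    proof
      show "{..n} \<subseteq> (\<lambda>i. n - i) ` {..n}"
      proof
        fix i assume "i \<in> {..n}"
        then show "i \<in> (\<lambda>i. n - i) ` {..n}" by (intro image_eqI[of _ _ "n - i"]) auto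
      qed
    qed auto
    have "coeff P (p \<otimes>\<^bsub>P\<^esub> q) n = (\<Oplus>i \<in> {..n}. coeff P p i \<otimes> coeff P q (n - i))"
      using p q by simp
    also have "\<dots> = (\<Oplus>i \<in> (\<lambda>i. n - i) ` {..n}. coeff P p i \<otimes> coeff P q (n - i))"
      by (simp only: img)
    also have "\<dots> = (\<Oplus>i \<in> {..n}. coeff P p (n - i) \<otimes> coeff P q (n - (n - i)))"
      using p q by (intro R.finsum_reindex) (auto simp: inj_on_def)
    also have "\<dots> = (\<Oplus>i \<in> {..n}. coeff P q i \<otimes> coeff P p (n - i))"
      using p q by (intro R.finsum_cong') (auto simp: R.center_commute[OF c])
    finally show "coeff P (p \<otimes>\<^bsub>P\<^esub> q) n = coeff P (q \<otimes>\<^bsub>P\<^esub> p) n" using p q by simp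
  qed (use p q in auto)
  then show ?thesis using p by (simp add: ring_center_def)
qed

locale polynomial_quotient = D: skew_field D + Q: skew_field Q
  for D :: "('a, 'm) ring_scheme" (structure) and Q :: "('q, 'n) ring_scheme" +
  fixes \<iota> :: "(nat \<Rightarrow> 'a) \<Rightarrow> 'q"
  assumes quotient: "quotient_division_ring (UP D) Q \<iota>"
begin

sublocale UP_ring D "UP D"
  by unfold_locales

sublocale iota: ring_hom_ring "UP D" Q \<iota>
  using quotient by (intro ring_hom_ringI2 UP_ring Q.ring_axioms) (simp add: quotient_division_ring_def)

lemma iota_eq_iff:
  "p \<in> carrier (UP D) \<Longrightarrow> q \<in> carrier (UP D) \<Longrightarrow> \<iota> p = \<iota> q \<longleftrightarrow> p = q"
  using quotient by (auto simp: quotient_division_ring_def dest: inj_onD)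

lemma iota_eq_zero_iff: "p \<in> carrier (UP D) \<Longrightarrow> \<iota> p = \<zero>\<^bsub>Q\<^esub> \<longleftrightarrow> p = \<zero>\<^bsub>UP D\<^esub>"
  using iota_eq_iff[of p "\<zero>\<^bsub>UP D\<^esub>"] by simp

lemma fraction:
  assumes "z \<in> carrier Q"
  obtains p q where "p \<in> carrier (UP D)" "q \<in> carrier (UP D)" "q \<noteq> \<zero>\<^bsub>UP D\<^esub>" "z \<otimes>\<^bsub>Q\<^esub> \<iota> q = \<iota> p"
proof -
  obtain p q where pq: "p \<in> carrier (UP D)" "q \<in> carrier (UP D)" "q \<noteq> \<zero>\<^bsub>UP D\<^esub>"
    and "z = \<iota> p \<otimes>\<^bsub>Q\<^esub> inv\<^bsub>Q\<^esub> \<iota> q"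
    using assms quotient by (auto simp: quotient_division_ring_def)
  then have "z \<otimes>\<^bsub>Q\<^esub> \<iota> q = \<iota> p" using iota_eq_zero_iff by (simp add: Q.m_assoc)
  then show thesis using that pq by blast
qed

lemma poly_mult_nonzero:
  assumes "p \<in> carrier (UP D)" "q \<in> carrier (UP D)" "p \<noteq> \<zero>\<^bsub>UP D\<^esub>" "q \<noteq> \<zero>\<^bsub>UP D\<^esub>"
  shows "p \<otimes>\<^bsub>UP D\<^esub> q \<noteq> \<zero>\<^bsub>UP D\<^esub>"
proof
  assume "p \<otimes>\<^bsub>UP D\<^esub> q = \<zero>\<^bsub>UP D\<^esub>"
  then have "\<iota> p \<otimes>\<^bsub>Q\<^esub> \<iota> q = \<zero>\<^bsub>Q\<^esub>" using assms(1,2) by (simp flip: iota.hom_mult)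
  then show False using assms by (simp add: Q.mult_eq_zero_iff iota_eq_zero_iff)
qed

text \<open>
  The left fraction \<open>q\<^sup>-\<^sup>1 p\<close> lies in the quotient ring and is thus also a right fraction
  \<open>r s\<^sup>-\<^sup>1\<close>. This is how sums and products of fractions get a common denominator.
\<close>

lemma right_Ore:
  assumes "p \<in> carrier (UP D)" "q \<in> carrier (UP D)" "q \<noteq> \<zero>\<^bsub>UP D\<^esub>"
  obtains r s where "r \<in> carrier (UP D)" "s \<in> carrier (UP D)" "s \<noteq> \<zero>\<^bsub>UP D\<^esub>"
    "p \<otimes>\<^bsub>UP D\<^esub> s = q \<otimes>\<^bsub>UP D\<^esub> r"
proof -
  have q: "\<iota> q \<noteq> \<zero>\<^bsub>Q\<^esub>" using assms iota_eq_zero_iff by simp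
  obtain r s where rs: "r \<in> carrier (UP D)" "s \<in> carrier (UP D)" "s \<noteq> \<zero>\<^bsub>UP D\<^esub>"
    and eq: "inv\<^bsub>Q\<^esub> \<iota> q \<otimes>\<^bsub>Q\<^esub> \<iota> p \<otimes>\<^bsub>Q\<^esub> \<iota> s = \<iota> r"
    using fraction[of "inv\<^bsub>Q\<^esub> \<iota> q \<otimes>\<^bsub>Q\<^esub> \<iota> p"] assms q by auto
  have "\<iota> (p \<otimes>\<^bsub>UP D\<^esub> s) = \<iota> q \<otimes>\<^bsub>Q\<^esub> inv\<^bsub>Q\<^esub> \<iota> q \<otimes>\<^bsub>Q\<^esub> (\<iota> p \<otimes>\<^bsub>Q\<^esub> \<iota> s)"
    using assms rs q by simp
  also have "\<dots> = \<iota> q \<otimes>\<^bsub>Q\<^esub> (inv\<^bsub>Q\<^esub> \<iota> q \<otimes>\<^bsub>Q\<^esub> \<iota> p \<otimes>\<^bsub>Q\<^esub> \<iota> s)"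
    using assms rs q by (simp flip: Q.m_assoc)
  also have "\<dots> = \<iota> (q \<otimes>\<^bsub>UP D\<^esub> r)"
    using assms rs by (simp add: eq)
  finally have "p \<otimes>\<^bsub>UP D\<^esub> s = q \<otimes>\<^bsub>UP D\<^esub> r"
    using rs assms by (simp only: iota_eq_iff UP_mult_closed)
  then show thesis using that rs by blast
qed

lemma iota_center:
  assumes p: "p \<in> ring_center (UP D)"
  shows "\<iota> p \<in> ring_center Q"
proof -
  have pc: "p \<in> carrier (UP D)" using p by (simp add: ring_center_def)
  have comm: "\<iota> p \<otimes>\<^bsub>Q\<^esub> \<iota> q = \<iota> q \<otimes>\<^bsub>Q\<^esub> \<iota> p" if "q \<in> carrier (UP D)" for q
    using p pc that by (simp add: ring_center_def flip: iota.hom_mult)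
  have "\<iota> p \<otimes>\<^bsub>Q\<^esub> z = z \<otimes>\<^bsub>Q\<^esub> \<iota> p" if z: "z \<in> carrier Q" for z
  proof -
    obtain a b where ab: "a \<in> carrier (UP D)" "b \<in> carrier (UP D)" "b \<noteq> \<zero>\<^bsub>UP D\<^esub>"
      and z: "z = \<iota> a \<otimes>\<^bsub>Q\<^esub> inv\<^bsub>Q\<^esub> \<iota> b"
      using z quotient by (auto simp: quotient_division_ring_def)
    have b: "\<iota> b \<noteq> \<zero>\<^bsub>Q\<^esub>" "inv\<^bsub>Q\<^esub> \<iota> b \<in> carrier Q" using ab iota_eq_zero_iff by simp_all
    have "\<iota> p \<otimes>\<^bsub>Q\<^esub> z = \<iota> a \<otimes>\<^bsub>Q\<^esub> (\<iota> p \<otimes>\<^bsub>Q\<^esub> inv\<^bsub>Q\<^esub> \<iota> b)"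
      using pc ab b comm[OF ab(1)] by (simp add: z flip: Q.m_assoc)
    also have "\<iota> p \<otimes>\<^bsub>Q\<^esub> inv\<^bsub>Q\<^esub> \<iota> b = inv\<^bsub>Q\<^esub> \<iota> b \<otimes>\<^bsub>Q\<^esub> \<iota> p"
      using pc ab b comm by (intro Q.commute_inv) auto
    finally show ?thesis using pc ab b by (simp add: z Q.m_assoc)
  qed
  then show ?thesis using pc by (simp add: ring_center_def)
qed

section \<open>Specialization of the indeterminate\<close>

text \<open>
  The function \<open>e\<close> gives the values of the fraction \<open>z = p q\<^sup>-\<^sup>1\<close> at all but finitely many points
  of \<open>K\<close>. A finite exceptional set is part of the notion because denominators change from one
  operation to the next and may acquire new roots. Cross-multiplied equations avoid any case
  distinction at the roots of \<open>q\<close>: where \<open>q(a) = 0\<close>, they merely do not determine \<open>e a\<close>.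
\<close>

definition specializes :: "'a set \<Rightarrow> 'q \<Rightarrow> ('a \<Rightarrow> 'a) \<Rightarrow> bool" where
  "specializes K z e \<longleftrightarrow> z \<in> carrier Q \<and> e \<in> K \<rightarrow> carrier D \<and>
    (\<exists>p \<in> carrier (UP D). \<exists>q \<in> carrier (UP D) - {\<zero>\<^bsub>UP D\<^esub>}. z \<otimes>\<^bsub>Q\<^esub> \<iota> q = \<iota> p \<and>
      finite {a \<in> K. e a \<otimes> eval_at D a q \<noteq> eval_at D a p})"

lemma specializesE:
  assumes "specializes K z e"
  obtains p q A where "z \<in> carrier Q" "\<And>a. a \<in> K \<Longrightarrow> e a \<in> carrier D"
    "p \<in> carrier (UP D)" "q \<in> carrier (UP D)" "q \<noteq> \<zero>\<^bsub>UP D\<^esub>" "z \<otimes>\<^bsub>Q\<^esub> \<iota> q = \<iota> p" "finite A"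
    "\<And>a. a \<in> K \<Longrightarrow> a \<notin> A \<Longrightarrow> e a \<otimes> eval_at D a q = eval_at D a p"
proof -
  obtain p q where pq: "z \<in> carrier Q" "e \<in> K \<rightarrow> carrier D"
    "p \<in> carrier (UP D)" "q \<in> carrier (UP D)" "q \<noteq> \<zero>\<^bsub>UP D\<^esub>" "z \<otimes>\<^bsub>Q\<^esub> \<iota> q = \<iota> p"
    "finite {a \<in> K. e a \<otimes> eval_at D a q \<noteq> eval_at D a p}"
    using assms by (auto simp: specializes_def)
  show thesis by (rule that[OF pq(1) _ pq(3-7)]) (use pq(2) in auto)
qed

lemma specializesI:
  assumes "z \<in> carrier Q" "\<And>a. a \<in> K \<Longrightarrow> e a \<in> carrier D"
    "p \<in> carrier (UP D)" "q \<in> carrier (UP D)" "q \<noteq> \<zero>\<^bsub>UP D\<^esub>" "z \<otimes>\<^bsub>Q\<^esub> \<iota> q = \<iota> p" "finite A"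
    "\<And>a. a \<in> K \<Longrightarrow> a \<notin> A \<Longrightarrow> e a \<otimes> eval_at D a q = eval_at D a p"
  shows "specializes K z e"
proof -
  have "finite {a \<in> K. e a \<otimes> eval_at D a q \<noteq> eval_at D a p}"
    by (rule finite_subset[OF _ assms(7)]) (use assms(8) in auto)
  then show ?thesis using assms(1-6) by (auto simp: specializes_def)
qed

context
  fixes K
  assumes K: "K \<subseteq> ring_center D"
begin

lemma eval_at_hom:
  assumes "a \<in> K"
  shows "ring_hom_ring (UP D) D (eval_at D a)"
  using assms K by (intro ring_hom_ringI2 UP_ring D.ring_axioms eval_at_ring_hom) auto

lemma eval_at_simps:
  assumes a: "a \<in> K" and p: "p \<in> carrier (UP D)" and q: "q \<in> carrier (UP D)"
  shows "eval_at D a p \<in> carrier D"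
    and "eval_at D a (p \<oplus>\<^bsub>UP D\<^esub> q) = eval_at D a p \<oplus> eval_at D a q"
    and "eval_at D a (p \<otimes>\<^bsub>UP D\<^esub> q) = eval_at D a p \<otimes> eval_at D a q"
    and "eval_at D a (\<ominus>\<^bsub>UP D\<^esub> p) = \<ominus> eval_at D a p"
proof -
  interpret ev: ring_hom_ring "UP D" D "eval_at D a" using a by (rule eval_at_hom)
  show "eval_at D a p \<in> carrier D"
    "eval_at D a (p \<oplus>\<^bsub>UP D\<^esub> q) = eval_at D a p \<oplus> eval_at D a q"
    "eval_at D a (p \<otimes>\<^bsub>UP D\<^esub> q) = eval_at D a p \<otimes> eval_at D a q"
    "eval_at D a (\<ominus>\<^bsub>UP D\<^esub> p) = \<ominus> eval_at D a p"
    using p q by simp_all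
qed

lemma specializes_exists:
  assumes z: "z \<in> carrier Q"
  shows "\<exists>e. specializes K z e"
proof -
  obtain p q where pq: "p \<in> carrier (UP D)" "q \<in> carrier (UP D)" "q \<noteq> \<zero>\<^bsub>UP D\<^esub>" "z \<otimes>\<^bsub>Q\<^esub> \<iota> q = \<iota> p"
    using fraction[OF z] by blast
  \<comment> \<open>The denominator has finitely many roots in \<open>K\<close>; any element of \<open>D\<close> will do as value there.\<close>
  define e where "e a = (if eval_at D a q = \<zero> then \<zero> else eval_at D a p \<otimes> inv eval_at D a q)" for a
  have "specializes K z e"
  proof (rule specializesI[OF z _ pq])
    show "finite {a \<in> K. eval_at D a q = \<zero>}"
      using pq K by (intro D.finite_central_roots)
  qed (use pq eval_at_simps in \<open>auto simp: e_def D.m_assoc\<close>)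
  then show ?thesis by blast
qed

lemma specializes_const:
  assumes d: "d \<in> carrier D"
  shows "specializes K (\<iota> (monom (UP D) d 0)) (\<lambda>_. d)"
proof (rule specializesI[where p = "monom (UP D) d 0" and q = "\<one>\<^bsub>UP D\<^esub>" and A = "{}"])
  show "\<one>\<^bsub>UP D\<^esub> \<noteq> \<zero>\<^bsub>UP D\<^esub>"
    using Q.one_not_zero iota_eq_zero_iff[of "\<one>\<^bsub>UP D\<^esub>"] by simp
  fix a assume "a \<in> K"
  then have "a \<in> carrier D" using K D.center_carrier by blast
  then show "d \<otimes> eval_at D a \<one>\<^bsub>UP D\<^esub> = eval_at D a (monom (UP D) d 0)"
    using d eval_at_const[of a \<one>] by (simp add: eval_at_const)
qed (use d in auto)

lemma specializes_neg:
  assumes "specializes K z e"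
  shows "specializes K (\<ominus>\<^bsub>Q\<^esub> z) (\<lambda>a. \<ominus> e a)"
  using assms
proof (rule specializesE)
  fix p q A assume *: "z \<in> carrier Q" "\<And>a. a \<in> K \<Longrightarrow> e a \<in> carrier D"
    "p \<in> carrier (UP D)" "q \<in> carrier (UP D)" "q \<noteq> \<zero>\<^bsub>UP D\<^esub>" "z \<otimes>\<^bsub>Q\<^esub> \<iota> q = \<iota> p" "finite A"
    "\<And>a. a \<in> K \<Longrightarrow> a \<notin> A \<Longrightarrow> e a \<otimes> eval_at D a q = eval_at D a p"
  show ?thesis
    by (rule specializesI[where p = "\<ominus>\<^bsub>UP D\<^esub> p" and q = q and A = A])
      (use * in \<open>auto simp: Q.l_minus D.l_minus eval_at_simps\<close>)
qed

lemma specializes_add: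
  assumes "specializes K z e" "specializes K z' e'"
  shows "specializes K (z \<oplus>\<^bsub>Q\<^esub> z') (\<lambda>a. e a \<oplus> e' a)"
proof -
  obtain p q A where 1: "z \<in> carrier Q" "\<And>a. a \<in> K \<Longrightarrow> e a \<in> carrier D"
    "p \<in> carrier (UP D)" "q \<in> carrier (UP D)" "q \<noteq> \<zero>\<^bsub>UP D\<^esub>" "z \<otimes>\<^bsub>Q\<^esub> \<iota> q = \<iota> p" "finite A"
    "\<And>a. a \<in> K \<Longrightarrow> a \<notin> A \<Longrightarrow> e a \<otimes> eval_at D a q = eval_at D a p"
    using specializesE[OF assms(1)] by blast
  obtain p' q' A' where 2: "z' \<in> carrier Q" "\<And>a. a \<in> K \<Longrightarrow> e' a \<in> carrier D"
    "p' \<in> carrier (UP D)" "q' \<in> carrier (UP D)" "q' \<noteq> \<zero>\<^bsub>UP D\<^esub>" "z' \<otimes>\<^bsub>Q\<^esub> \<iota> q' = \<iota> p'" "finite A'"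
    "\<And>a. a \<in> K \<Longrightarrow> a \<notin> A' \<Longrightarrow> e' a \<otimes> eval_at D a q' = eval_at D a p'"
    using specializesE[OF assms(2)] by blast
  \<comment> \<open>The common denominator \<open>q s = q' r\<close> gives the numerator \<open>p s + p' r\<close>.\<close>
  obtain r s where rs: "r \<in> carrier (UP D)" "s \<in> carrier (UP D)" "s \<noteq> \<zero>\<^bsub>UP D\<^esub>"
    "q \<otimes>\<^bsub>UP D\<^esub> s = q' \<otimes>\<^bsub>UP D\<^esub> r"
    using right_Ore[OF 1(4) 2(4,5)] by blast
  have iota: "\<iota> q \<otimes>\<^bsub>Q\<^esub> \<iota> s = \<iota> q' \<otimes>\<^bsub>Q\<^esub> \<iota> r"
    using rs(4) 1 2 rs by (simp flip: iota.hom_mult)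
  show ?thesis
  proof (rule specializesI[where p = "p \<otimes>\<^bsub>UP D\<^esub> s \<oplus>\<^bsub>UP D\<^esub> p' \<otimes>\<^bsub>UP D\<^esub> r" and q = "q \<otimes>\<^bsub>UP D\<^esub> s"
        and A = "A \<union> A'"])
    show "q \<otimes>\<^bsub>UP D\<^esub> s \<noteq> \<zero>\<^bsub>UP D\<^esub>" using 1 rs by (intro poly_mult_nonzero)
    have "(z \<oplus>\<^bsub>Q\<^esub> z') \<otimes>\<^bsub>Q\<^esub> \<iota> (q \<otimes>\<^bsub>UP D\<^esub> s) =
        z \<otimes>\<^bsub>Q\<^esub> (\<iota> q \<otimes>\<^bsub>Q\<^esub> \<iota> s) \<oplus>\<^bsub>Q\<^esub> z' \<otimes>\<^bsub>Q\<^esub> (\<iota> q' \<otimes>\<^bsub>Q\<^esub> \<iota> r)"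
      using 1 2 rs iota by (simp add: Q.l_distr)
    also have "\<dots> = \<iota> p \<otimes>\<^bsub>Q\<^esub> \<iota> s \<oplus>\<^bsub>Q\<^esub> \<iota> p' \<otimes>\<^bsub>Q\<^esub> \<iota> r"
      using 1(1,3,4) 2(1,3,4) rs(1-3) by (simp add: 1(6) 2(6) flip: Q.m_assoc)
    finally show "(z \<oplus>\<^bsub>Q\<^esub> z') \<otimes>\<^bsub>Q\<^esub> \<iota> (q \<otimes>\<^bsub>UP D\<^esub> s) =
        \<iota> (p \<otimes>\<^bsub>UP D\<^esub> s \<oplus>\<^bsub>UP D\<^esub> p' \<otimes>\<^bsub>UP D\<^esub> r)"
      using 1 2 rs by simp
    fix a assume a: "a \<in> K" "a \<notin> A \<union> A'"
    define E where "E = eval_at D a"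
    have cl: "E t \<in> carrier D" if "t \<in> carrier (UP D)" for t
      unfolding E_def using eval_at_simps a that by blast
    have E: "e a \<otimes> E q = E p" "e' a \<otimes> E q' = E p'" unfolding E_def using a 1 2 by auto
    have ev: "E q \<otimes> E s = E q' \<otimes> E r"
      using rs(4) eval_at_simps(3)[OF a(1)] 1 2 rs unfolding E_def by metis
    have "(e a \<oplus> e' a) \<otimes> (E q \<otimes> E s) = e a \<otimes> (E q \<otimes> E s) \<oplus> e' a \<otimes> (E q' \<otimes> E r)"
      using 1 2 rs a cl ev by (simp add: D.l_distr)
    also have "\<dots> = E p \<otimes> E s \<oplus> E p' \<otimes> E r"
      using 1(2-4) 2(2-4) rs(1-3) a cl by (simp add: E flip: D.m_assoc)
    finally show "(e a \<oplus> e' a) \<otimes> eval_at D a (q \<otimes>\<^bsub>UP D\<^esub> s) =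
        eval_at D a (p \<otimes>\<^bsub>UP D\<^esub> s \<oplus>\<^bsub>UP D\<^esub> p' \<otimes>\<^bsub>UP D\<^esub> r)"
      using 1(3,4) 2(3) rs(1-3) a unfolding E_def by (simp add: eval_at_simps)
  qed (use 1 2 rs in auto)
qed

lemma specializes_mult:
  assumes "specializes K z e" "specializes K z' e'"
  shows "specializes K (z \<otimes>\<^bsub>Q\<^esub> z') (\<lambda>a. e a \<otimes> e' a)"
proof -
  obtain p q A where 1: "z \<in> carrier Q" "\<And>a. a \<in> K \<Longrightarrow> e a \<in> carrier D"
    "p \<in> carrier (UP D)" "q \<in> carrier (UP D)" "q \<noteq> \<zero>\<^bsub>UP D\<^esub>" "z \<otimes>\<^bsub>Q\<^esub> \<iota> q = \<iota> p" "finite A"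
    "\<And>a. a \<in> K \<Longrightarrow> a \<notin> A \<Longrightarrow> e a \<otimes> eval_at D a q = eval_at D a p"
    using specializesE[OF assms(1)] by blast
  obtain p' q' A' where 2: "z' \<in> carrier Q" "\<And>a. a \<in> K \<Longrightarrow> e' a \<in> carrier D"
    "p' \<in> carrier (UP D)" "q' \<in> carrier (UP D)" "q' \<noteq> \<zero>\<^bsub>UP D\<^esub>" "z' \<otimes>\<^bsub>Q\<^esub> \<iota> q' = \<iota> p'" "finite A'"
    "\<And>a. a \<in> K \<Longrightarrow> a \<notin> A' \<Longrightarrow> e' a \<otimes> eval_at D a q' = eval_at D a p'"
    using specializesE[OF assms(2)] by blast
  \<comment> \<open>From \<open>q\<^sup>-\<^sup>1 p' = r s\<^sup>-\<^sup>1\<close> follows \<open>p q\<^sup>-\<^sup>1 p' q'\<^sup>-\<^sup>1 = p r (q' s)\<^sup>-\<^sup>1\<close>.\<close>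
  obtain r s where rs: "r \<in> carrier (UP D)" "s \<in> carrier (UP D)" "s \<noteq> \<zero>\<^bsub>UP D\<^esub>"
    "p' \<otimes>\<^bsub>UP D\<^esub> s = q \<otimes>\<^bsub>UP D\<^esub> r"
    using right_Ore[OF 2(3) 1(4,5)] by blast
  have iota: "\<iota> p' \<otimes>\<^bsub>Q\<^esub> \<iota> s = \<iota> q \<otimes>\<^bsub>Q\<^esub> \<iota> r"
    using rs(4) 1 2 rs by (simp flip: iota.hom_mult)
  show ?thesis
  proof (rule specializesI[where p = "p \<otimes>\<^bsub>UP D\<^esub> r" and q = "q' \<otimes>\<^bsub>UP D\<^esub> s" and A = "A \<union> A'"])
    show "q' \<otimes>\<^bsub>UP D\<^esub> s \<noteq> \<zero>\<^bsub>UP D\<^esub>" using 2 rs by (intro poly_mult_nonzero)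
    have "(z \<otimes>\<^bsub>Q\<^esub> z') \<otimes>\<^bsub>Q\<^esub> \<iota> (q' \<otimes>\<^bsub>UP D\<^esub> s) = z \<otimes>\<^bsub>Q\<^esub> ((z' \<otimes>\<^bsub>Q\<^esub> \<iota> q') \<otimes>\<^bsub>Q\<^esub> \<iota> s)"
      using 1(1) 2(1,4) rs(2) by (simp add: Q.m_assoc)
    also have "\<dots> = (z \<otimes>\<^bsub>Q\<^esub> \<iota> q) \<otimes>\<^bsub>Q\<^esub> \<iota> r"
      using 1(1,4) rs(1) by (simp only: 2(6) iota) (simp add: Q.m_assoc)
    finally show "(z \<otimes>\<^bsub>Q\<^esub> z') \<otimes>\<^bsub>Q\<^esub> \<iota> (q' \<otimes>\<^bsub>UP D\<^esub> s) = \<iota> (p \<otimes>\<^bsub>UP D\<^esub> r)"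
      using 1 rs by simp
    fix a assume a: "a \<in> K" "a \<notin> A \<union> A'"
    define E where "E = eval_at D a"
    have cl: "E t \<in> carrier D" if "t \<in> carrier (UP D)" for t
      unfolding E_def using eval_at_simps a that by blast
    have E: "e a \<otimes> E q = E p" "e' a \<otimes> E q' = E p'" unfolding E_def using a 1 2 by auto
    have ev: "E p' \<otimes> E s = E q \<otimes> E r"
      using rs(4) eval_at_simps(3)[OF a(1)] 1 2 rs unfolding E_def by metis
    have "(e a \<otimes> e' a) \<otimes> (E q' \<otimes> E s) = e a \<otimes> ((e' a \<otimes> E q') \<otimes> E s)"
      using 1(2)[OF a(1)] 2(2)[OF a(1)] 2(4) rs(2) cl by (simp add: D.m_assoc)
    also have "\<dots> = (e a \<otimes> E q) \<otimes> E r"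
      using 1(2)[OF a(1)] 1(4) rs(1) cl by (simp only: E(2) ev) (simp add: D.m_assoc)
    finally show "(e a \<otimes> e' a) \<otimes> eval_at D a (q' \<otimes>\<^bsub>UP D\<^esub> s) = eval_at D a (p \<otimes>\<^bsub>UP D\<^esub> r)"
      using 1 2 rs a E unfolding E_def by (simp add: eval_at_simps)
  qed (use 1 2 rs in auto)
qed

lemma specializes_signed_eval:
  assumes x: "specializes K x ex" and y: "specializes K y ey"
  shows "specializes K (signed_eval Q x y z) (\<lambda>a. signed_eval D (ex a) (ey a) z)"
proof -
  have one: "specializes K \<one>\<^bsub>Q\<^esub> (\<lambda>_. \<one>)"
    using specializes_const[of \<one>] by simp
  have zero: "specializes K \<zero>\<^bsub>Q\<^esub> (\<lambda>_. \<zero>)"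
    using specializes_const[of \<zero>] by simp
  have word: "specializes K (word_eval Q x y w) (\<lambda>a. word_eval D (ex a) (ey a) w)" for w
  proof (induction w)
    case Nil
    then show ?case using one by simp
  next
    case (Cons b w)
    then show ?case using specializes_mult[OF x] specializes_mult[OF y] by (cases b) auto
  qed
  have "specializes K (signed_word_eval Q x y p) (\<lambda>a. signed_word_eval D (ex a) (ey a) p)" for p
    using word specializes_neg[OF word] by (cases p; cases "fst p") auto
  then show ?thesis
    using zero specializes_add by (induction z) (auto simp: signed_eval_def)
qed

text \<open>
  If \<open>z = p q\<^sup>-\<^sup>1\<close> is nonzero, so is \<open>p\<close>, and outside the exceptional set \<open>e a = 0\<close> forces
  \<open>p(a) = 0\<close>. The finitely many roots of \<open>p\<close> in \<open>K\<close> are then the only further ones.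
\<close>

lemma specializes_nonzero:
  assumes "specializes K z e" "z \<noteq> \<zero>\<^bsub>Q\<^esub>"
  shows "finite {a \<in> K. e a = \<zero>}"
  using assms(1)
proof (rule specializesE)
  fix p q A assume *: "z \<in> carrier Q" "\<And>a. a \<in> K \<Longrightarrow> e a \<in> carrier D"
    "p \<in> carrier (UP D)" "q \<in> carrier (UP D)" "q \<noteq> \<zero>\<^bsub>UP D\<^esub>" "z \<otimes>\<^bsub>Q\<^esub> \<iota> q = \<iota> p" "finite A"
    "\<And>a. a \<in> K \<Longrightarrow> a \<notin> A \<Longrightarrow> e a \<otimes> eval_at D a q = eval_at D a p"
  have "\<iota> q \<noteq> \<zero>\<^bsub>Q\<^esub>" using * iota_eq_zero_iff by blast
  then have "\<iota> p \<noteq> \<zero>\<^bsub>Q\<^esub>" using *(1,4) assms(2) by (simp add: Q.mult_eq_zero_iff flip: *(6))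
  then have "p \<noteq> \<zero>\<^bsub>UP D\<^esub>" using *(3) iota_eq_zero_iff by blast
  then have "finite (A \<union> {a \<in> K. eval_at D a p = \<zero>})"
    using K * by (simp add: D.finite_central_roots)
  moreover have "{a \<in> K. e a = \<zero>} \<subseteq> A \<union> {a \<in> K. eval_at D a p = \<zero>}"
  proof
    fix a assume "a \<in> {a \<in> K. e a = \<zero>}"
    then have a: "a \<in> K" "e a = \<zero>" by auto
    show "a \<in> A \<union> {a \<in> K. eval_at D a p = \<zero>}"
      using *(8)[OF a(1)] a eval_at_simps(1)[OF a(1) *(4) *(4)] by (cases "a \<in> A") auto
  qed
  ultimately show ?thesis by (rule finite_subset[rotated])
qed

text \<open>
  Each of the countably many inequations that make \<open>x, y\<close> free survives at all but finitely many
  points of \<open>K\<close>. As \<open>K\<close> is uncountable, they all survive at a common point.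
\<close>

theorem capelli_free_specialization:
  assumes K': "uncountable K"
    and xy: "x \<in> carrier Q" "y \<in> carrier Q" and free: "capelli_free Q x y"
  shows "\<exists>x' \<in> carrier D. \<exists>y' \<in> carrier D. capelli_free D x' y'"
proof -
  obtain ex ey where e: "specializes K x ex" "specializes K y ey"
    using specializes_exists xy by blast
  define bad where "bad ws = {a \<in> K. signed_eval D (ex a) (ey a) (capelli_words ws) = \<zero>}" for ws
  have "finite (bad ws)" if "distinct ws" "ws \<noteq> []" for ws
    unfolding bad_def using free that
    by (intro specializes_nonzero[OF specializes_signed_eval[OF e]]) (auto simp: capelli_free_def)
  then have "countable (\<Union>ws \<in> {ws. distinct ws \<and> ws \<noteq> []}. bad ws)"
    by (intro countable_UN countableI_type) (auto intro: countable_finite)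
  then have "\<not> K \<subseteq> (\<Union>ws \<in> {ws. distinct ws \<and> ws \<noteq> []}. bad ws)"
    using K' countable_subset by blast
  then obtain a where a: "a \<in> K" "\<And>ws. distinct ws \<Longrightarrow> ws \<noteq> [] \<Longrightarrow> a \<notin> bad ws"
    by blast
  have "capelli_free D (ex a) (ey a)"
    using a by (auto simp: capelli_free_def bad_def)
  moreover have "ex a \<in> carrier D" "ey a \<in> carrier D"
    using e a(1) by (auto simp: specializes_def)
  ultimately show ?thesis by blast
qed

end

end

section \<open>The equivalence\<close>

theorem proposition2p1:
  fixes D :: "('a, 'm) ring_scheme"
    and K :: "'a set"
    and Q :: "('q, 'n) ring_scheme"
    and \<iota> :: "(nat \<Rightarrow> 'a) \<Rightarrow> 'q"
  assumes "division_algebra K D"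
    and "uncountable K"
    and "quotient_division_ring (UP D) Q \<iota>"
  shows "(contains_free_algebra D K \<longleftrightarrow> contains_free_algebra Q (rat_funs K D Q \<iota>)) \<and>
    (contains_free_algebra Q (rat_funs K D Q \<iota>) \<longleftrightarrow>
      contains_free_algebra Q (const_image K D \<iota>))"
proof -
  interpret polynomial_quotient D Q \<iota>
    using assms by (auto simp: polynomial_quotient_def polynomial_quotient_axioms_def
        division_algebra_def quotient_division_ring_def)
  have K: "K \<subseteq> ring_center D" and sub: "subring K D"
    using assms(1) by (auto simp: division_algebra_def intro: subfieldE(1))
  have units: "{\<zero>\<^bsub>D\<^esub>, \<one>\<^bsub>D\<^esub>, \<ominus>\<^bsub>D\<^esub> \<one>\<^bsub>D\<^esub>} \<subseteq> K"
    using subringE(2,3,5)[OF sub] by auto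
  have KD: "c \<in> carrier D" if "c \<in> K" for c using K that D.center_carrier by blast
  have const: "monom (UP D) c 0 \<in> polys_over K D" if "c \<in> K" for c
    using that units KD by (auto simp: polys_over_def)
  have one_nz: "\<one>\<^bsub>UP D\<^esub> \<noteq> \<zero>\<^bsub>UP D\<^esub>"
    using Q.one_not_zero iota_eq_zero_iff[of "\<one>\<^bsub>UP D\<^esub>"] by simp
  have polys_center: "\<iota> p \<in> ring_center Q" if "p \<in> polys_over K D" for p
    using that K by (intro iota_center central_coeffs_imp_central) (auto simp: polys_over_def)
  have rat_center: "rat_funs K D Q \<iota> \<subseteq> ring_center Q"
    unfolding rat_funs_def
    by (auto intro!: Q.center_mult Q.center_inv polys_center)
      (auto simp: iota_eq_zero_iff polys_over_def)
  have const_rat: "const_image K D \<iota> \<subseteq> rat_funs K D Q \<iota>"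
  proof
    fix z assume "z \<in> const_image K D \<iota>"
    then obtain c where c: "c \<in> K" "z = \<iota> (monom (UP D) c 0)" by (auto simp: const_image_def)
    have "\<one>\<^bsub>UP D\<^esub> \<in> polys_over K D" using const[of "\<one>\<^bsub>D\<^esub>"] units by simp
    moreover have "z = \<iota> (monom (UP D) c 0) \<otimes>\<^bsub>Q\<^esub> inv\<^bsub>Q\<^esub> \<iota> \<one>\<^bsub>UP D\<^esub>"
      using c KD by simp
    ultimately show "z \<in> rat_funs K D Q \<iota>"
      unfolding rat_funs_def using const[OF c(1)] one_nz by blast
  qed
  have const_units: "{\<zero>\<^bsub>Q\<^esub>, \<one>\<^bsub>Q\<^esub>, \<ominus>\<^bsub>Q\<^esub> \<one>\<^bsub>Q\<^esub>} \<subseteq> const_image K D \<iota>"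
  proof -
    have "\<zero>\<^bsub>Q\<^esub> = \<iota> (monom (UP D) \<zero>\<^bsub>D\<^esub> 0)" "\<one>\<^bsub>Q\<^esub> = \<iota> (monom (UP D) \<one>\<^bsub>D\<^esub> 0)"
      "\<ominus>\<^bsub>Q\<^esub> \<one>\<^bsub>Q\<^esub> = \<iota> (monom (UP D) (\<ominus>\<^bsub>D\<^esub> \<one>\<^bsub>D\<^esub>) 0)"
      by simp_all
    then show ?thesis using units unfolding const_image_def by blast
  qed
  have freeD: "contains_free_algebra D K \<longleftrightarrow>
      (\<exists>x \<in> carrier D. \<exists>y \<in> carrier D. capelli_free D x y)"
    using units K by (rule D.contains_free_algebra_iff)
  have freeQ: "contains_free_algebra Q F \<longleftrightarrow>
      (\<exists>x \<in> carrier Q. \<exists>y \<in> carrier Q. capelli_free Q x y)"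
    if "F = rat_funs K D Q \<iota> \<or> F = const_image K D \<iota>" for F
    using that const_units const_rat rat_center by (intro Q.contains_free_algebra_iff) auto
  have hom: "(\<lambda>d. \<iota> (monom (UP D) d 0)) \<in> ring_hom D Q"
    using ring_hom_trans[OF const_ring_hom iota.homh] by (simp add: comp_def)
  have inj: "inj_on (\<lambda>d. \<iota> (monom (UP D) d 0)) (carrier D)"
    using monom_inj[of 0] by (auto simp: inj_on_def iota_eq_iff)
  have "capelli_free Q (\<iota> (monom (UP D) x 0)) (\<iota> (monom (UP D) y 0))"
    if "x \<in> carrier D" "y \<in> carrier D" "capelli_free D x y" for x y
    by (rule capelli_free_ring_hom[OF D.ring_axioms Q.ring_axioms hom inj that])
  then have "(\<exists>x \<in> carrier D. \<exists>y \<in> carrier D. capelli_free D x y) \<longleftrightarrow>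
      (\<exists>x \<in> carrier Q. \<exists>y \<in> carrier Q. capelli_free Q x y)"
    using capelli_free_specialization[OF K assms(2)] ring_hom_closed[OF hom] by meson
  then show ?thesis
    using freeD freeQ by simp
qed

end
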